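(* Let $p\in(1,\infty)$ and $q\in(0,1)$. There exist universal constants $c>0$, $\gamma>0$, $\delta_0\in(0,1)$ and a constant $C_{p,q}>0$ depending only on $p$ and $q$ such that the following holds. Let $\sigma_1>0$, $N\ge2$ and $\sigma_j=\sigma_1q^{j-1}$ for $1\le j\le N$, with associated $p$-ellipsoid $\mathcal{E}_p\subset\mathbb{R}^N$. Then for every $0<\delta\le\delta_0$ and every integer $n$ with $c\log(1/\delta)\le n<N$, $$\mathbb{P}\left(\frac{1}{C_{p,q}\sqrt{\log(1/\delta)}}\,\sqrt n\,\sigma_{n+1}\le\mathcal{R}_n(\mathcal{E}_p)\le C_{p,q}\,\frac{\sqrt{\log(1/\delta)}}{\delta}\,\sqrt n\,\sigma_{n+1}\right)\ge1-2\delta-ne^{-\gamma n}.$$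
   Context: $\mathcal{E}_p=\{x\in\mathbb{R}^N:\sum_{i=1}^N(|x_i|/\sigma_i)^p\le1\}$. The $n$-th random radius is $\mathcal{R}_n(\mathcal{E}_p)=\max_{y\in E_n\cap\mathcal{E}_p}|y|$, where $|\cdot|$ is the Euclidean norm and $E_n$ is a random $n$-codimensional linear subspace of $\mathbb{R}^N$ distributed according to the normalized Haar measure on the Grassmannian. *)

theory Defs
  imports "HOL-Probability.Probability" "HOL-Library.Function_Algebras"
begin

text \<open>
  The dimension \<open>N\<close> is quantified after the constants in the statement, so it cannot be
  a type. A vector of \<open>\<real>\<^sup>N\<close> is a function \<open>nat \<Rightarrow> real\<close> that vanishes outside the
  coordinate range \<open>{1..N}\<close>; addition is the pointwise one from
  \<^theory>\<open>HOL-Library.Function_Algebras\<close>, and the linear algebra (\<open>subspace\<close>, \<open>dim\<close>) comes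
  from the interpretation below.
\<close>

global_interpretation coord: vector_space "\<lambda>(c::real) (x::nat \<Rightarrow> real) i. c * x i"
  by unfold_locales (auto simp: fun_eq_iff algebra_simps)

definition rn_space :: "nat \<Rightarrow> (nat \<Rightarrow> real) set" where
  "rn_space N = {x. \<forall>i. i \<notin> {1..N} \<longrightarrow> x i = 0}"

abbreviation rn_norm :: "nat \<Rightarrow> (nat \<Rightarrow> real) \<Rightarrow> real" where
  "rn_norm N x \<equiv> L2_set x {1..N}"

definition rn_inner :: "nat \<Rightarrow> (nat \<Rightarrow> real) \<Rightarrow> (nat \<Rightarrow> real) \<Rightarrow> real" where
  "rn_inner N x y = (\<Sum>i=1..N. x i * y i)"

definition rn_unit :: "nat \<Rightarrow> nat \<Rightarrow> real" where
  "rn_unit j = (\<lambda>i. if i = j then 1 else 0)"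

definition ellipsoid :: "nat \<Rightarrow> real \<Rightarrow> (nat \<Rightarrow> real) \<Rightarrow> (nat \<Rightarrow> real) set" where
  "ellipsoid N p \<sigma> = {x \<in> rn_space N. (\<Sum>i=1..N. (\<bar>x i\<bar> / \<sigma> i) powr p) \<le> 1}"

text \<open>The \<open>n\<close>-codimensional linear subspaces of \<open>\<real>\<^sup>N\<close>.\<close>

definition grassmannian :: "nat \<Rightarrow> nat \<Rightarrow> (nat \<Rightarrow> real) set set" where
  "grassmannian N n = {E. coord.subspace E \<and> E \<subseteq> rn_space N \<and> coord.dim E + n = N}"

text \<open>
  The usual topology of the Grassmannian: subspaces are identified with the matrices of
  their orthogonal projections. Only the entries with indices in \<open>{1..N}\<close> matter; the
  remaining ones are set to zero.
\<close>

definition orth_proj :: "nat \<Rightarrow> (nat \<Rightarrow> real) set \<Rightarrow> (nat \<Rightarrow> real) \<Rightarrow> (nat \<Rightarrow> real)" where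
  "orth_proj N E x = (THE y. y \<in> E \<and> (\<forall>z\<in>E. rn_inner N (\<lambda>i. x i - y i) z = 0))"

definition proj_matrix :: "nat \<Rightarrow> (nat \<Rightarrow> real) set \<Rightarrow> nat \<Rightarrow> nat \<Rightarrow> real" where
  "proj_matrix N E = (\<lambda>i j. if i \<in> {1..N} \<and> j \<in> {1..N}
                            then orth_proj N E (rn_unit j) i else 0)"

definition grassmannian_top :: "nat \<Rightarrow> nat \<Rightarrow> (nat \<Rightarrow> real) set topology" where
  "grassmannian_top N n = pullback_topology (grassmannian N n) (proj_matrix N) euclidean"

definition grassmannian_borel :: "nat \<Rightarrow> nat \<Rightarrow> (nat \<Rightarrow> real) set measure" where
  "grassmannian_borel N n = sigma (grassmannian N n) {U. openin (grassmannian_top N n) U}"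

definition orthogonal_mat :: "nat \<Rightarrow> (nat \<Rightarrow> nat \<Rightarrow> real) \<Rightarrow> bool" where
  "orthogonal_mat N A \<longleftrightarrow>
     (\<forall>i\<in>{1..N}. \<forall>j\<in>{1..N}. (\<Sum>k=1..N. A k i * A k j) = (if i = j then 1 else 0))"

definition mat_app :: "nat \<Rightarrow> (nat \<Rightarrow> nat \<Rightarrow> real) \<Rightarrow> (nat \<Rightarrow> real) \<Rightarrow> (nat \<Rightarrow> real)" where
  "mat_app N A x = (\<lambda>i. if i \<in> {1..N} then \<Sum>j=1..N. A i j * x j else 0)"

text \<open>
  The normalized Haar measure on the Grassmannian is the unique Borel probability measure
  that is invariant under the action \<open>E \<mapsto> A E\<close> of the orthogonal group.
\<close>

definition haar_grassmannian :: "nat \<Rightarrow> nat \<Rightarrow> (nat \<Rightarrow> real) set measure \<Rightarrow> bool" where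
  "haar_grassmannian N n \<mu> \<longleftrightarrow>
     prob_space \<mu> \<and> sets \<mu> = sets (grassmannian_borel N n) \<and>
     (\<forall>A. orthogonal_mat N A \<longrightarrow>
       (\<forall>B\<in>sets \<mu>. emeasure \<mu> ((\<lambda>E. mat_app N A ` E) ` B) = emeasure \<mu> B))"

text \<open>
  The maximum defining the radius is attained whenever the semi-axes are positive, since
  the ellipsoid is then compact; so the supremum below is that maximum.
\<close>

definition section_radius :: "nat \<Rightarrow> (nat \<Rightarrow> real) set \<Rightarrow> (nat \<Rightarrow> real) set \<Rightarrow> real" where
  "section_radius N K E = (SUP y\<in>E \<inter> K. rn_norm N y)"

end

theory Submission
  imports Defs
begin

text \<open>
  The proof reads both bounds off the position of \<open>E\<close> relative to coordinate subspaces of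
  dimension \<open>n + 1\<close>. For \<open>j > n\<close> let \<open>H\<^sub>j\<close> be the span of \<open>e\<^sub>1, \<dots>, e\<^sub>n, e\<^sub>j\<close>. The section
  \<open>E \<inter> H\<^sub>j\<close> is nonzero by counting dimensions, and by rotation invariance it points in a
  uniformly random direction of an \<open>(n+1)\<close>-dimensional space.

  Upper bound. Suppose that for every \<open>j > n\<close> some unit vector of \<open>E \<inter> H\<^sub>j\<close> has \<open>j\<close>-th
  coordinate larger than \<open>t\<^sub>j > 0\<close> in absolute value. Rescaled to have \<open>j\<close>-th coordinate 1,
  these vectors form a basis \<open>w\<^sub>j\<close> of \<open>E\<close>, so that \<open>E\<close> is a graph over the last \<open>N - n\<close>
  coordinates and every \<open>y\<close> in \<open>E\<close> is the sum of the \<open>y\<^sub>j w\<^sub>j\<close>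
  (\<open>grassmannian_graph_representation\<close>). Since \<open>\<bar>y\<^sub>j\<bar> \<le> \<sigma>\<^sub>j\<close> on the ellipsoid, the radius is
  at most \<open>\<Sum>\<^sub>j \<sigma>\<^sub>j / t\<^sub>j\<close> (\<open>section_radius_le\<close>). A coordinate of a random unit vector in
  dimension \<open>n + 1\<close> is below \<open>t\<close> with probability at most of order \<open>t \<surd>n\<close>. Taking \<open>t\<^sub>j\<close> of order
  \<open>\<delta> q\<^bsup>(j-n-1)/2\<^esup> / \<surd>n\<close>, up to a factor polynomial in \<open>j - n\<close>,
  half of the geometric decay of \<open>\<sigma>\<^sub>j\<close> pays for the union bound over \<open>j\<close> and the other half makes the series for the radius converge to a multiple of
  \<open>\<surd>n \<sigma>\<^sub>n\<^sub>+\<^sub>1 / \<delta>\<close>.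

  Lower bound. On the same event \<open>E \<inter> H\<^sub>n\<^sub>+\<^sub>1\<close> is a line. With high probability each coordinate
  \<open>x\<^sub>i\<close> of its unit vector is at most of order \<open>\<surd>((n + 2 - i) log(1/\<delta>) / n)\<close>. Because
  \<open>\<sigma>\<^sub>i = \<sigma>\<^sub>n\<^sub>+\<^sub>1 q\<^bsup>-(n+1-i)\<^esup>\<close>, the quotients \<open>\<bar>x\<^sub>i\<bar> / \<sigma>\<^sub>i\<close> form a convergent series dominated by
  the last indices, and the multiple of \<open>x\<close> of length about
  \<open>\<surd>n \<sigma>\<^sub>n\<^sub>+\<^sub>1 / \<surd>(log(1/\<delta>))\<close> still lies in the ellipsoid (\<open>section_radius_ge\<close>). For \<open>p \<ge> 1\<close>
  the sum of the \<open>p\<close>-th powers is at most the sum itself once all terms are at most 1,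
  which reduces membership in the ellipsoid to that series.

  Probabilities. Invariance of the measure suffices
  (\<open>measure_directions_bounded_le\<close>). Consider the event that all unit vectors \<open>x\<close> of
  \<open>E \<inter> H\<close> satisfy \<open>\<alpha> \<bar>\<langle>x,u\<rangle>\<bar> \<le> \<beta> \<bar>u\<bar>\<close>. A reflection of \<open>H\<close> that exchanges two directions
  carries the event of one to that of the other, so its probability does not depend on the
  direction \<open>u\<close> and can be averaged over a standard Gaussian \<open>u\<close> in \<open>H\<close>. By
  Fubini it is then enough to fix \<open>E\<close> and one unit vector \<open>x\<close> of the section, for which \<open>\<langle>x,u\<rangle>\<close> is a standard normal variable and
  \<open>\<bar>u\<bar>\<close> is concentrated. The choices \<open>(\<alpha>,\<beta>) = (1,t)\<close> and \<open>(-1,-s)\<close> give the two estimates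
  on coordinates. The norm of the Gaussian vector enters once per coordinate in the lower
  bound, which is where the term \<open>n exp(-\<gamma> n)\<close> comes from.

  Measurability of the events and of the radius rests on two facts: a vector lies in \<open>E\<close>
  exactly if the projection matrix of \<open>E\<close> fixes it, and an existential quantifier over a
  compact set of vectors can be replaced by countable operations
  (\<open>sets_Collect_ex_zero_on_compact\<close>).
\<close>

section \<open>Linear algebra of coordinate vectors\<close>

definition supported_on :: "nat set \<Rightarrow> (nat \<Rightarrow> real) set" where
  "supported_on I = {x. \<forall>i. i \<notin> I \<longrightarrow> x i = 0}"

lemma rn_space_eq_supported_on: "rn_space N = supported_on {1..N}"
  by (simp add: rn_space_def supported_on_def)

lemma supported_on_eq_sum_units:
  assumes "finite I" "x \<in> supported_on I"
  shows "x = (\<Sum>i\<in>I. (\<lambda>k. x i * rn_unit i k))"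
proof
  fix k
  have "(\<Sum>i\<in>I. (\<lambda>k. x i * rn_unit i k)) k = (\<Sum>i\<in>I. x i * rn_unit i k)"
    by (induction I rule: infinite_finite_induct) auto
  also have "\<dots> = (\<Sum>i\<in>I. if i = k then x k else 0)"
    by (intro sum.cong) (auto simp: rn_unit_def)
  also have "\<dots> = x k"
    using assms by (auto simp: supported_on_def)
  finally show "x k = (\<Sum>i\<in>I. (\<lambda>k. x i * rn_unit i k)) k" by simp
qed

lemma supported_on_subset_span_units:
  assumes "finite I"
  shows "supported_on I \<subseteq> coord.span (rn_unit ` I)"
proof
  fix x assume x: "x \<in> supported_on I"
  have "(\<Sum>i\<in>I. (\<lambda>k. x i * rn_unit i k)) \<in> coord.span (rn_unit ` I)"
    by (intro coord.span_sum coord.span_scale coord.span_base) auto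
  thus "x \<in> coord.span (rn_unit ` I)"
    using supported_on_eq_sum_units[OF assms x] by simp
qed

lemma card_independent_supported_on:
  assumes "finite I" "coord.independent B" "B \<subseteq> supported_on I"
  shows "finite B" "card B \<le> card I"
proof -
  have "finite B \<and> card B \<le> card (rn_unit ` I)"
    using assms supported_on_subset_span_units[OF assms(1)]
    by (intro coord.independent_span_bound) auto
  thus "finite B" "card B \<le> card I" using card_image_le[OF assms(1), of rn_unit] by auto
qed

text \<open>
  The space of all functions \<open>nat \<Rightarrow> real\<close> is infinite dimensional, so finite-dimensional
  facts about \<open>dim\<close> hold only relative to \<open>rn_space N\<close>, whose unit vectors bound the size
  of every independent set.
\<close>

lemma independent_card_le_dim_rn:
  assumes "E \<subseteq> rn_space N" "coord.independent B" "B \<subseteq> E"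
  shows "card B \<le> coord.dim E"
proof -
  obtain C where C: "C \<subseteq> E" "coord.independent C" "E \<subseteq> coord.span C" "card C = coord.dim E"
    using coord.basis_exists by blast
  have "finite C"
    using C assms(1) by (intro card_independent_supported_on[of "{1..N}"])
      (auto simp: rn_space_eq_supported_on)
  thus ?thesis
    using coord.independent_span_bound[of C B] assms C by auto
qed

lemma independent_spans_if_card_eq_dim:
  assumes "E \<subseteq> rn_space N" "coord.independent B" "B \<subseteq> E" "card B = coord.dim E"
  shows "E \<subseteq> coord.span B"
proof
  fix x assume x: "x \<in> E"
  show "x \<in> coord.span B"
  proof (rule ccontr)
    assume n: "x \<notin> coord.span B"
    hence "coord.independent (insert x B)"
      using assms by (intro coord.independent_insertI)
    hence "card (insert x B) \<le> coord.dim E"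
      using assms x by (intro independent_card_le_dim_rn[of E N]) auto
    moreover have "finite B"
      using assms by (intro card_independent_supported_on[of "{1..N}"])
       (auto simp: rn_space_eq_supported_on)
    moreover have "x \<notin> B" using n coord.span_base by blast
    ultimately show False using assms by simp
  qed
qed

abbreviation coord_linear where
  "coord_linear \<equiv> Vector_Spaces.linear
     (\<lambda>(c::real) (x::nat \<Rightarrow> real) i. c * x i) (\<lambda>(c::real) (x::nat \<Rightarrow> real) i. c * x i)"

global_interpretation coord_pair: vector_space_pair
  "\<lambda>(c::real) (x::nat \<Rightarrow> real) i. c * x i" "\<lambda>(c::real) (x::nat \<Rightarrow> real) i. c * x i"
  by unfold_locales

lemma coord_linearI:
  assumes "\<And>x y. f (x + y) = f x + f y" "\<And>c x. f (\<lambda>i. c * x i) = (\<lambda>i. c * f x i)"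
  shows "coord_linear f"
  using assms by unfold_locales auto

text \<open>
  Dimension count: erasing the coordinates in \<open>I\<close> maps \<open>E\<close>, of dimension \<open>N - n\<close>, to
  vectors with only \<open>N - n - 1\<close> coordinates, so this map has a nonzero kernel on \<open>E\<close>.
\<close>

lemma exists_nonzero_supported_on:
  assumes E: "E \<in> grassmannian N n" and n: "n < N" and I: "I \<subseteq> {1..N}" "card I = n + 1"
  obtains x where "x \<in> E" "x \<in> supported_on I" "x \<noteq> 0"
proof (rule ccontr)
  assume contr: "\<not> thesis"
  define r where "r x = (\<lambda>i. if i \<in> I then 0 else x i :: real)" for x
  have lin: "coord_linear r"
    by (intro coord_linearI) (auto simp: r_def fun_eq_iff)
  have sub: "coord.subspace E" "E \<subseteq> rn_space N" "coord.dim E + n = N"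
    using E by (auto simp: grassmannian_def)
  obtain B where B: "B \<subseteq> E" "coord.independent B" "E \<subseteq> coord.span B" "card B = coord.dim E"
    using coord.basis_exists by blast
  have span: "coord.span B = E"
    using B sub coord.span_minimal by blast
  have inj: "inj_on r (coord.span B)"
  proof (subst coord_pair.linear_inj_on_iff_eq_0[OF lin], simp, safe)
    fix x assume x: "x \<in> coord.span B" "r x = 0"
    hence "x i = 0" if "i \<notin> I" for i
      using that by (auto simp: r_def fun_eq_iff dest: spec[of _ i])
    hence "x \<in> supported_on I" by (auto simp: supported_on_def)
    thus "x = 0" using x span contr that by blast
  qed
  have "coord.independent (r ` B)"
    using B inj coord_pair.linear_independent_injective_image[OF lin] by blast
  moreover have "r ` B \<subseteq> supported_on ({1..N} - I)"
    using B sub by (auto simp: r_def supported_on_def rn_space_def)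
  ultimately have "card (r ` B) \<le> card ({1..N} - I)"
    by (intro card_independent_supported_on) auto
  moreover have "card (r ` B) = card B"
    using inj_on_subset[OF inj coord.span_superset] by (rule card_image)
  moreover have "card ({1..N} - I) = N - (n+1)"
    using I by (subst card_Diff_subset) (auto intro: finite_subset)
  ultimately show False using B sub n by simp
qed

lemma grassmannian_linear_image:
  assumes E: "E \<in> grassmannian N n" and lin: "coord_linear f" and inj: "inj_on f (rn_space N)"
    and maps: "f ` rn_space N \<subseteq> rn_space N"
  shows "f ` E \<in> grassmannian N n"
proof -
  have sub: "coord.subspace E" "E \<subseteq> rn_space N" "coord.dim E + n = N"
    using E by (auto simp: grassmannian_def)
  obtain B where B: "B \<subseteq> E" "coord.independent B" "E \<subseteq> coord.span B" "card B = coord.dim E"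
    using coord.basis_exists by blast
  have span: "coord.span B = E"
    using B sub coord.span_minimal by blast
  have inj': "inj_on f E" using inj sub by (metis inj_on_subset)
  have "coord.dim (f ` E) = coord.dim E"
  proof (rule coord.dim_unique)
    show "f ` B \<subseteq> f ` E" using B by blast
    show "f ` E \<subseteq> coord.span (f ` B)"
      using coord_pair.linear_span_image[OF lin] span by simp
    show "coord.independent (f ` B)"
      using B inj' coord_pair.linear_independent_injective_image[OF lin] span by simp
    show "card (f ` B) = coord.dim E"
      using B inj' by (metis card_image inj_on_subset)
  qed
  moreover have "coord.subspace (f ` E)"
    using coord_pair.linear_subspace_image[OF lin] sub by blast
  ultimately show ?thesis using sub maps by (auto simp: grassmannian_def)
qed

section \<open>Gaussian vectors\<close>

abbreviation std_gaussian :: "real measure" where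
  "std_gaussian \<equiv> density lborel (\<lambda>x. ennreal (std_normal_density x))"

definition gaussian_vector :: "nat set \<Rightarrow> (nat \<Rightarrow> real) measure" where
  "gaussian_vector I = PiM I (\<lambda>_. std_gaussian)"

lemma prob_space_std_gaussian: "prob_space std_gaussian"
  by (rule prob_space_normal_density) simp

lemma prob_space_gaussian_vector: "prob_space (gaussian_vector I)"
  unfolding gaussian_vector_def by (intro prob_space_PiM prob_space_std_gaussian)

lemma sets_gaussian_vector [measurable_cong]:
  "sets (gaussian_vector I) = sets (PiM I (\<lambda>_. borel))"
  unfolding gaussian_vector_def by (intro sets_PiM_cong) auto

text \<open>
  Multiplying the standard normal density by \<open>exp (s x\<^sup>2)\<close> gives, up to the factor
  \<open>\<tau> = (1 - 2s)\<^bsup>-1/2\<^esup>\<close>, the normal density with standard deviation \<open>\<tau>\<close>. The cases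
  \<open>s = 1/4\<close> and \<open>s = -3/2\<close> yield all exponential tail bounds below.
\<close>

lemma nn_integral_exp_square_gaussian:
  assumes "s < 1 / 2"
  shows "(\<integral>\<^sup>+x. ennreal (exp (s * x\<^sup>2)) \<partial>std_gaussian) = ennreal (1 / sqrt (1 - 2 * s))"
proof -
  define \<tau> where "\<tau> = 1 / sqrt (1 - 2 * s)"
  have \<tau>: "\<tau> > 0" "\<tau>\<^sup>2 = 1 / (1 - 2 * s)"
    using assms by (auto simp: \<tau>_def power_divide)
  have eq: "std_normal_density x * exp (s * x\<^sup>2) = \<tau> * normal_density 0 \<tau> x" for x
  proof -
    have "- x\<^sup>2 / 2 + s * x\<^sup>2 = - x\<^sup>2 / (2 * \<tau>\<^sup>2)"
      unfolding \<tau>(2) using assms by (simp add: field_simps)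
    moreover have "sqrt (2 * pi * \<tau>\<^sup>2) = \<tau> * sqrt (2 * pi)"
      using \<tau>(1) by (simp add: real_sqrt_mult)
    ultimately show ?thesis
      using \<tau>(1) by (simp add: normal_density_def mult.assoc flip: exp_add)
  qed
  have "(\<integral>\<^sup>+x. ennreal (exp (s * x\<^sup>2)) \<partial>std_gaussian)
      = (\<integral>\<^sup>+x. ennreal (std_normal_density x) * ennreal (exp (s * x\<^sup>2)) \<partial>lborel)"
    by (subst nn_integral_density) auto
  also have "\<dots> = (\<integral>\<^sup>+x. ennreal \<tau> * ennreal (normal_density 0 \<tau> x) \<partial>lborel)"
    using \<tau>(1) by (intro nn_integral_cong) (simp add: eq flip: ennreal_mult)
  also have "\<dots> = ennreal \<tau> * (\<integral>\<^sup>+x. ennreal (normal_density 0 \<tau> x) \<partial>lborel)"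
    by (rule nn_integral_cmult) auto
  also have "(\<integral>\<^sup>+x. ennreal (normal_density 0 \<tau> x) \<partial>lborel) = 1"
    using \<tau>(1) by (subst nn_integral_eq_integral) auto
  finally show ?thesis by (simp add: \<tau>_def)
qed

lemma nn_integral_exp_norm_square_gaussian_vector:
  assumes "finite I" "s < 1 / 2"
  shows "(\<integral>\<^sup>+G. ennreal (exp (s * (\<Sum>i\<in>I. (G i)\<^sup>2))) \<partial>gaussian_vector I)
    = ennreal ((1 / sqrt (1 - 2 * s)) ^ card I)"
proof -
  interpret product_sigma_finite "\<lambda>_. std_gaussian"
    using prob_space_std_gaussian
    by (simp add: product_sigma_finite_def prob_space_imp_sigma_finite)
  have "(\<integral>\<^sup>+G. ennreal (exp (s * (\<Sum>i\<in>I. (G i)\<^sup>2))) \<partial>gaussian_vector I)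
     = (\<integral>\<^sup>+G. (\<Prod>i\<in>I. ennreal (exp (s * (G i)\<^sup>2))) \<partial>gaussian_vector I)"
    using assms by (intro nn_integral_cong)
      (simp add: sum_distrib_left exp_sum prod_ennreal)
  also have "\<dots> = (\<Prod>i\<in>I. ennreal (1 / sqrt (1 - 2 * s)))"
    unfolding gaussian_vector_def
    using assms by (subst product_nn_integral_prod)
      (auto simp: nn_integral_exp_square_gaussian)
  also have "\<dots> = ennreal ((1 / sqrt (1 - 2 * s)) ^ card I)"
    using assms by (simp add: prod_ennreal ennreal_power)
  finally show ?thesis .
qed

lemma markov_exp:
  assumes "prob_space M" and [measurable]: "X \<in> borel_measurable M"
    and int: "(\<integral>\<^sup>+x. ennreal (exp (X x)) \<partial>M) = ennreal b" and b: "0 \<le> b"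
  shows "measure M {x \<in> space M. a \<le> X x} \<le> b * exp (- a)"
proof -
  interpret prob_space M by fact
  have "emeasure M {x \<in> space M. a \<le> X x}
     = emeasure M {x \<in> space M. 1 \<le> ennreal (exp (-a)) * ennreal (exp (X x))}"
    by (intro arg_cong[of _ _ "emeasure M"] Collect_cong)
       (simp flip: ennreal_mult ennreal_1 exp_add)
  also have "\<dots> \<le> ennreal (exp (-a)) * (\<integral>\<^sup>+x. ennreal (exp (X x)) * indicator (space M) x \<partial>M)"
    by (intro nn_integral_Markov_inequality) auto
  also have "(\<integral>\<^sup>+x. ennreal (exp (X x)) * indicator (space M) x \<partial>M) = (\<integral>\<^sup>+x. ennreal (exp (X x)) \<partial>M)"
    by (intro nn_integral_cong) auto
  also have "ennreal (exp (-a)) * \<dots> = ennreal (b * exp (-a))"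
    using b by (simp add: int mult.commute flip: ennreal_mult)
  finally show ?thesis
    using b by (simp add: emeasure_eq_measure)
qed

lemma measurable_L2_set [measurable]:
  assumes "finite I"
  shows "(\<lambda>G. L2_set G I) \<in> borel_measurable (PiM I (\<lambda>_. borel))"
  unfolding L2_set_def using assms by measurable

lemma L2_set_square: "(L2_set f I)\<^sup>2 = (\<Sum>i\<in>I. (f i)\<^sup>2)"
  by (simp add: L2_set_def sum_nonneg)

lemma gaussian_vector_norm_upper_tail:
  assumes "finite I" "R \<ge> 0"
  shows "measure (gaussian_vector I) {G \<in> space (gaussian_vector I). R \<le> L2_set G I}
    \<le> exp (real (card I) / 2 - R\<^sup>2 / 4)"
proof -
  have "measure (gaussian_vector I) {G \<in> space (gaussian_vector I). R \<le> L2_set G I}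
     = measure (gaussian_vector I) {G \<in> space (gaussian_vector I).
          R\<^sup>2 / 4 \<le> (1/4) * (\<Sum>i\<in>I. (G i)\<^sup>2)}"
    using assms by (intro arg_cong[of _ _ "measure (gaussian_vector I)"] Collect_cong)
      (simp add: abs_le_square_iff[symmetric] L2_set_square[symmetric] L2_set_nonneg)
  also have "\<dots> \<le> (sqrt 2) ^ card I * exp (- (R\<^sup>2 / 4))"
    using nn_integral_exp_norm_square_gaussian_vector[OF assms(1), of "1/4"]
    by (intro markov_exp prob_space_gaussian_vector)
       (simp_all add: real_sqrt_divide)
  also have "sqrt 2 \<le> exp (1/2 :: real)"
  proof (rule real_le_lsqrt)
    have "(2::real) \<le> exp 1" using exp_ge_add_one_self[of 1] by simp
    thus "2 \<le> (exp (1/2::real))\<^sup>2" by (simp flip: exp_double)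
  qed auto
  hence "(sqrt 2) ^ card I * exp (- (R\<^sup>2 / 4)) \<le> exp (1/2) ^ card I * exp (- (R\<^sup>2 / 4))"
    by (intro mult_right_mono power_mono) auto
  also have "\<dots> = exp (real (card I) / 2 - R\<^sup>2 / 4)"
    by (simp flip: exp_of_nat_mult exp_add)
  finally show ?thesis .
qed

text \<open>
  The exponential Markov inequality with exponent \<open>-3/2\<close> gives the base \<open>exp (1/2) / 2\<close>,
  which is less than \<open>exp (-1/6)\<close> because \<open>ln 2 \<ge> 2/3\<close>.
\<close>

lemma gaussian_vector_norm_lower_tail:
  assumes "finite I"
  shows "measure (gaussian_vector I)
           {G \<in> space (gaussian_vector I). L2_set G I \<le> sqrt (real (card I) / 3)}
    \<le> exp (- real (card I) / 6)"
proof -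
  let ?m = "real (card I)"
  have "measure (gaussian_vector I) {G \<in> space (gaussian_vector I). L2_set G I \<le> sqrt (?m / 3)}
     = measure (gaussian_vector I) {G \<in> space (gaussian_vector I).
          - (?m / 2) \<le> (- 3 / 2) * (\<Sum>i\<in>I. (G i)\<^sup>2)}"
    by (intro arg_cong[of _ _ "measure (gaussian_vector I)"] Collect_cong conj_cong)
      (auto simp: L2_set_def)
  also have "\<dots> \<le> (1 / 2) ^ card I * exp (- (- (?m / 2)))"
    using nn_integral_exp_norm_square_gaussian_vector[OF assms(1), of "-3/2"] assms
    by (intro markov_exp prob_space_gaussian_vector)
       (simp_all add: real_sqrt_divide)
  also have "(1/2 :: real) = exp (- ln 2)" by (simp add: exp_minus)
  also have "exp (- ln 2) ^ card I * exp (- (- (?m / 2))) = exp (?m * (1/2 - ln (2::real)))"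
    by (simp add: algebra_simps flip: exp_of_nat_mult exp_add)
  also have "\<dots> \<le> exp (?m * (- 1 / 6))"
    using ln2_ge_two_thirds by (intro iffD2[OF exp_le_cancel_iff] mult_left_mono) auto
  finally show ?thesis by simp
qed

lemma distr_gaussian_coordinate:
  assumes "i \<in> I"
  shows "distr (gaussian_vector I) borel (\<lambda>G. G i) = std_gaussian"
proof -
  interpret product_prob_space "\<lambda>_. std_gaussian" I
    by (simp add: product_prob_spaceI prob_space_std_gaussian)
  have "distr (gaussian_vector I) borel (\<lambda>G. G i) = distr (gaussian_vector I) std_gaussian (\<lambda>G. G i)"
    by (intro distr_cong) auto
  also have "\<dots> = std_gaussian"
    unfolding gaussian_vector_def using PiM_component[OF assms] by simp
  finally show ?thesis .
qed

lemma distributed_gaussian_coordinate: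
  assumes "i \<in> I"
  shows "distributed (gaussian_vector I) lborel (\<lambda>G. G i) std_normal_density"
proof -
  have "distr (gaussian_vector I) lborel (\<lambda>G. G i) = distr (gaussian_vector I) borel (\<lambda>G. G i)"
    by (intro distr_cong) auto
  thus ?thesis
    using assms by (auto simp: distributed_def distr_gaussian_coordinate)
qed

lemma indep_vars_gaussian_vector:
  assumes "J \<subseteq> I" "J \<noteq> {}"
  shows "prob_space.indep_vars (gaussian_vector I) (\<lambda>_. borel) (\<lambda>i G. G i) J"
proof -
  interpret prob_space "gaussian_vector I" by (rule prob_space_gaussian_vector)
  have "distr (gaussian_vector I) (PiM I (\<lambda>_. borel)) (\<lambda>x. \<lambda>i\<in>I. x i)
      = distr (gaussian_vector I) (gaussian_vector I) (\<lambda>x. x)"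
    by (intro distr_cong) (auto simp: sets_gaussian_vector space_PiM gaussian_vector_def cong: sets_PiM_cong)
  also have "\<dots> = gaussian_vector I" by (rule distr_id2) simp
  also have "\<dots> = (\<Pi>\<^sub>M i\<in>I. distr (gaussian_vector I) borel (\<lambda>G. G i))"
    by (subst gaussian_vector_def, intro PiM_cong) (simp_all add: distr_gaussian_coordinate)
  finally have "indep_vars (\<lambda>_. borel) (\<lambda>i G. G i) I"
    using assms by (intro indep_vars_iff_distr_eq_PiM'[THEN iffD2]) auto
  thus ?thesis using assms by (rule_tac indep_vars_subset)
qed

text \<open>
  A combination of independent centred normal variables is normal, and its variance is the
  sum of the squared coefficients.
\<close>

lemma distributed_gaussian_marginal:
  assumes "finite I" and unit: "(\<Sum>i\<in>I. (x i)\<^sup>2) = 1"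
  shows "distributed (gaussian_vector I) lborel (\<lambda>G. \<Sum>i\<in>I. x i * G i) std_normal_density"
proof -
  interpret prob_space "gaussian_vector I" by (rule prob_space_gaussian_vector)
  \<comment> \<open>A vanishing coefficient would give a degenerate normal law, so only the support of
    \<open>x\<close> is used.\<close>
  define J where "J = {i\<in>I. x i \<noteq> 0}"
  have J: "finite J" "J \<subseteq> I" using assms by (auto simp: J_def)
  have sumJ: "(\<Sum>i\<in>J. (x i)\<^sup>2) = 1"
    using assms unfolding unit[symmetric] J_def by (intro sum.mono_neutral_left) auto
  hence "J \<noteq> {}" by auto
  have "indep_vars (\<lambda>_. borel) (\<lambda>i G. G i) J"
    using J \<open>J \<noteq> {}\<close> assms by (intro indep_vars_gaussian_vector) auto
  hence "indep_vars (\<lambda>_. borel) (\<lambda>i G. x i * G i) J"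
    by (rule indep_vars_compose2) auto
  moreover have "distributed (gaussian_vector I) lborel (\<lambda>G. x i * G i)
                   (normal_density 0 \<bar>x i\<bar>)" if "i \<in> J" for i
    using normal_density_affine[OF distributed_gaussian_coordinate[of i I], of "x i" 0] that
    by (simp add: J_def)
  ultimately have "distributed (gaussian_vector I) lborel (\<lambda>G. \<Sum>i\<in>J. x i * G i)
      (normal_density (\<Sum>i\<in>J. 0) (sqrt (\<Sum>i\<in>J. \<bar>x i\<bar>\<^sup>2)))"
    using J \<open>J \<noteq> {}\<close> by (intro sum_indep_normal) (auto simp: J_def)
  moreover have "(\<Sum>i\<in>J. x i * G i) = (\<Sum>i\<in>I. x i * G i)" for G
    using assms unfolding J_def by (intro sum.mono_neutral_left) auto
  ultimately show ?thesis by (simp add: sumJ)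
qed

text \<open>
  The standard normal density is at most \<open>1 / sqrt (2 pi) \<le> 1/2\<close>.
\<close>

lemma gaussian_marginal_small_ball:
  assumes "finite I" "(\<Sum>i\<in>I. (x i)\<^sup>2) = 1" "a \<ge> 0"
  shows "measure (gaussian_vector I)
      {G \<in> space (gaussian_vector I). \<bar>\<Sum>i\<in>I. x i * G i\<bar> \<le> a} \<le> a"
proof -
  interpret prob_space "gaussian_vector I" by (rule prob_space_gaussian_vector)
  have "emeasure (gaussian_vector I)
      ((\<lambda>G. \<Sum>i\<in>I. x i * G i) -` {-a..a} \<inter> space (gaussian_vector I))
     = (\<integral>\<^sup>+z. ennreal (std_normal_density z) * indicator {-a..a} z \<partial>lborel)"
    by (rule distributed_emeasure[OF distributed_gaussian_marginal[OF assms(1,2)]]) auto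
  also have "\<dots> \<le> (\<integral>\<^sup>+z. ennreal (1/2) * indicator {-a..a} z \<partial>lborel)"
  proof (intro nn_integral_mono mult_right_mono ennreal_leI)
    fix z :: real
    have "2 \<le> sqrt (2 * pi)" using pi_ge_two by (intro real_le_rsqrt) auto
    hence "1 / sqrt (2 * pi) \<le> 1 / 2" by (intro divide_left_mono) auto
    hence "1 / sqrt (2 * pi) * exp (- z\<^sup>2 / 2) \<le> 1 / 2 * 1"
      by (intro mult_mono) auto
    thus "std_normal_density z \<le> 1 / 2" by (simp add: std_normal_density_def)
  qed auto
  also have "\<dots> = ennreal a"
    using assms(3) by (subst nn_integral_cmult_indicator) (auto simp del: ennreal_half simp flip: ennreal_mult)
  also have "(\<lambda>G. \<Sum>i\<in>I. x i * G i) -` {-a..a} \<inter> space (gaussian_vector I)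
     = {G \<in> space (gaussian_vector I). \<bar>\<Sum>i\<in>I. x i * G i\<bar> \<le> a}" by auto
  finally show ?thesis using assms(3) by (simp add: emeasure_eq_measure)
qed

lemma gaussian_marginal_tail:
  assumes "finite I" "(\<Sum>i\<in>I. (x i)\<^sup>2) = 1" "a \<ge> 0"
  shows "measure (gaussian_vector I)
      {G \<in> space (gaussian_vector I). a \<le> \<bar>\<Sum>i\<in>I. x i * G i\<bar>} \<le> sqrt 2 * exp (- (a\<^sup>2 / 4))"
proof -
  let ?Z = "\<lambda>G. \<Sum>i\<in>I. x i * G i"
  have "measure (gaussian_vector I) {G \<in> space (gaussian_vector I). a \<le> \<bar>?Z G\<bar>}
    = measure (gaussian_vector I) {G \<in> space (gaussian_vector I). a\<^sup>2 / 4 \<le> (1/4) * (?Z G)\<^sup>2}"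
    using assms by (intro arg_cong[of _ _ "measure (gaussian_vector I)"] Collect_cong)
      (simp add: abs_le_square_iff[symmetric])
  also have "\<dots> \<le> sqrt 2 * exp (- (a\<^sup>2 / 4))"
  proof (intro markov_exp prob_space_gaussian_vector)
    have "(\<integral>\<^sup>+G. ennreal (exp (1/4 * (?Z G)\<^sup>2)) \<partial>gaussian_vector I)
        = (\<integral>\<^sup>+z. ennreal (std_normal_density z) * ennreal (exp (1/4 * z\<^sup>2)) \<partial>lborel)"
      by (rule distributed_nn_integral[OF distributed_gaussian_marginal[OF assms(1,2)], symmetric]) auto
    also have "\<dots> = (\<integral>\<^sup>+z. ennreal (exp (1/4 * z\<^sup>2)) \<partial>std_gaussian)"
      by (subst nn_integral_density) auto
    also have "\<dots> = ennreal (sqrt 2)"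
      by (subst nn_integral_exp_square_gaussian) (auto simp: real_sqrt_divide)
    finally show "(\<integral>\<^sup>+G. ennreal (exp (1/4 * (?Z G)\<^sup>2)) \<partial>gaussian_vector I) = ennreal (sqrt 2)" .
  qed auto
  finally show ?thesis .
qed

section \<open>Orthogonal projections and measurability on the Grassmannian\<close>

text \<open>
  A continuous function on a compact set attains its infimum, so it has a value
  \<open>\<le> 0\<close> exactly if its infimum is \<open>\<le> 0\<close>. The infimum is already determined by countably
  many points, one in each basic open set that meets the compact set.
\<close>

lemma sets_Collect_ex_zero_on_compact:
  fixes f :: "'a \<Rightarrow> 'b::second_countable_topology \<Rightarrow> real"
  assumes X: "compact X"
    and meas: "\<And>x. x \<in> X \<Longrightarrow> (\<lambda>w. f w x) \<in> borel_measurable M"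
    and cont: "\<And>w. w \<in> space M \<Longrightarrow> continuous_on X (f w)"
  shows "{w \<in> space M. \<exists>x\<in>X. f w x \<le> 0} \<in> sets M"
proof -
  obtain \<B> :: "'b set set" where \<B>: "countable \<B>" "topological_basis \<B>"
    using ex_countable_basis by blast
  define \<C> where "\<C> = {B\<in>\<B>. B \<inter> X \<noteq> {}}"
  define pt where "pt B = (SOME x. x \<in> B \<inter> X)" for B
  have pt: "pt B \<in> B \<inter> X" if "B \<in> \<C>" for B
  proof -
    have "\<exists>x. x \<in> B \<inter> X" using that by (auto simp: \<C>_def)
    thus ?thesis unfolding pt_def by (rule someI_ex)
  qed
  have "countable \<C>" using \<B>(1) by (auto simp: \<C>_def)
  have iff: "(\<exists>x\<in>X. f w x \<le> 0) \<longleftrightarrow> (\<forall>k::nat. \<exists>B\<in>\<C>. f w (pt B) < 1 / (real k + 1))"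
    if w: "w \<in> space M" for w
  proof safe
    fix x and k :: nat assume x: "x \<in> X" "f w x \<le> 0"
    have "open {..< 1 / (real k + 1)}" by simp
    then obtain U where U: "open U" "U \<inter> X = f w -` {..< 1 / (real k + 1)} \<inter> X"
      using cont[OF w] unfolding continuous_on_open_invariant by metis
    have "f w x < 1 / (real k + 1)" using x(2) by (rule le_less_trans) simp
    hence "x \<in> U" using x(1) U(2) by blast
    then obtain B where B: "B \<in> \<B>" "x \<in> B" "B \<subseteq> U"
      using \<B>(2) U(1) by (meson topological_basisE)
    hence "B \<in> \<C>" using x by (auto simp: \<C>_def)
    moreover have "f w (pt B) < 1 / (real k + 1)"
      using pt[OF \<open>B \<in> \<C>\<close>] B U by blast
    ultimately show "\<exists>B\<in>\<C>. f w (pt B) < 1 / (real k + 1)" by blast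
  next
    assume *: "\<forall>k::nat. \<exists>B\<in>\<C>. f w (pt B) < 1 / (real k + 1)"
    hence "X \<noteq> {}" using pt by blast
    then obtain x0 where x0: "x0 \<in> X" "\<And>x. x \<in> X \<Longrightarrow> f w x0 \<le> f w x"
      using continuous_attains_inf[OF X _ cont[OF w]] by blast
    have "f w x0 \<le> 0"
    proof (rule ccontr)
      assume "\<not> f w x0 \<le> 0"
      then obtain k :: nat where k: "1 / (real k + 1) < f w x0"
        using nat_approx_posE[of "f w x0"] by (metis add.commute linorder_not_le of_nat_Suc)
      obtain B where "B \<in> \<C>" "f w (pt B) < 1 / (real k + 1)" using * by blast
      thus False using x0(2)[of "pt B"] pt[of B] k by auto
    qed
    thus "\<exists>x\<in>X. f w x \<le> 0" using x0 by blast
  qed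
  have "{w \<in> space M. \<exists>x\<in>X. f w x \<le> 0}
      = {w \<in> space M. \<forall>k::nat. \<exists>B\<in>\<C>. f w (pt B) < 1 / (real k + 1)}"
    using iff by blast
  also have "\<dots> \<in> sets M"
  proof (intro sets.sets_Collect_countable_All sets.sets_Collect_countable_Ex' \<open>countable \<C>\<close>)
    fix k :: nat and B assume "B \<in> \<C>"
    hence [measurable]: "(\<lambda>w. f w (pt B)) \<in> borel_measurable M"
      using pt meas by blast
    show "{w \<in> space M. f w (pt B) < 1 / (real k + 1)} \<in> sets M" by measurable
  qed
  finally show ?thesis .
qed

lemma compact_coordinatewise_bounded:
  assumes "closed T" and bound: "\<And>x i. x \<in> T \<Longrightarrow> \<bar>x i\<bar> \<le> (b i :: real)"
  shows "compact (T :: (nat \<Rightarrow> real) set)"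
proof -
  have "compactin (product_topology (\<lambda>i. euclidean) UNIV) (PiE UNIV (\<lambda>i. {- b i..b i}))"
    by (subst compactin_PiE) auto
  hence "compact (PiE UNIV (\<lambda>i. {- b i..b i}))"
    by (simp add: euclidean_product_topology)
  moreover have "T \<subseteq> PiE UNIV (\<lambda>i. {- b i..b i})"
  proof
    fix x assume "x \<in> T"
    hence "\<bar>x i\<bar> \<le> b i" for i by (rule bound)
    hence "x i \<in> {- b i..b i}" for i by (simp add: abs_le_iff minus_le_iff)
    thus "x \<in> PiE UNIV (\<lambda>i. {- b i..b i})" by (simp add: PiE_UNIV_domain)
  qed
  ultimately show ?thesis
    using assms(1) by (metis compact_Int_closed inf.absorb_iff2)
qed

lemma closed_supported_on: "closed (supported_on I)"
proof -
  have "supported_on I = (\<Inter>i\<in>-I. {x. x i = 0})" by (auto simp: supported_on_def)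
  also have "closed \<dots>"
    by (intro closed_INT ballI closed_Collect_eq continuous_on_product_coordinates) auto
  finally show ?thesis .
qed

definition unit_sphere :: "nat set \<Rightarrow> (nat \<Rightarrow> real) set" where
  "unit_sphere I = {x \<in> supported_on I. (\<Sum>i\<in>I. (x i)\<^sup>2) = 1}"

lemma continuous_on_coordinate [continuous_intros]:
  "continuous_on S (\<lambda>x :: nat \<Rightarrow> real. x i)"
  by (rule continuous_on_subset[OF continuous_on_product_coordinates]) simp

lemma compact_unit_sphere:
  assumes "finite I"
  shows "compact (unit_sphere I)"
proof (rule compact_coordinatewise_bounded[where b = "\<lambda>_. 1"])
  have "closed {x :: nat \<Rightarrow> real. (\<Sum>i\<in>I. (x i)\<^sup>2) = 1}"
    by (intro closed_Collect_eq continuous_intros)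
  moreover have "unit_sphere I = supported_on I \<inter> {x. (\<Sum>i\<in>I. (x i)\<^sup>2) = 1}"
    by (auto simp: unit_sphere_def)
  ultimately show "closed (unit_sphere I)" by (simp add: closed_Int closed_supported_on)
  fix x i assume x: "x \<in> unit_sphere I"
  show "\<bar>x i\<bar> \<le> 1"
  proof (cases "i \<in> I")
    case True
    have "(x i)\<^sup>2 \<le> (\<Sum>i\<in>I. (x i)\<^sup>2)" using True assms by (intro member_le_sum) auto
    thus ?thesis using x by (simp add: unit_sphere_def abs_square_le_1)
  qed (use x in \<open>auto simp: unit_sphere_def supported_on_def\<close>)
qed

text \<open>
  One Gram-Schmidt step: with \<open>d\<close> the component of the new vector \<open>b\<close> orthogonal to the span
  of \<open>B\<close>, the projection of \<open>x\<close> onto the larger span gains the multiple of \<open>d\<close> with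
  coefficient \<open>\<langle>x - y, d\<rangle> / \<langle>d, d\<rangle>\<close>.
\<close>

lemma orth_proj_exists:
  assumes "finite B" "B \<subseteq> rn_space N"
  shows "\<exists>y\<in>coord.span B. \<forall>z\<in>coord.span B. rn_inner N (\<lambda>i. x i - y i) z = 0"
  using assms
proof (induction B arbitrary: x rule: finite_induct)
  case empty
  show ?case by (auto simp: rn_inner_def)
next
  case (insert b B)
  obtain b' where b': "b' \<in> coord.span B" "\<And>z. z \<in> coord.span B \<Longrightarrow> rn_inner N (\<lambda>i. b i - b' i) z = 0"
    using insert by blast
  obtain y where y: "y \<in> coord.span B" "\<And>z. z \<in> coord.span B \<Longrightarrow> rn_inner N (\<lambda>i. x i - y i) z = 0"
    using insert by blast
  define d where "d = (\<lambda>i. b i - b' i)"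
  define t where "t = rn_inner N (\<lambda>i. x i - y i) d / rn_inner N d d"
  have dB: "rn_inner N d z = 0" if "z \<in> coord.span B" for z using b' that by (simp add: d_def)
  have lin1: "rn_inner N u (\<lambda>i. v i + k * w i) = rn_inner N u v + k * rn_inner N u w" for u v w k
    by (simp add: rn_inner_def algebra_simps sum.distrib sum_distrib_left)
  have lin2: "rn_inner N (\<lambda>i. u i - k * v i) w = rn_inner N u w - k * rn_inner N v w" for u v w k
    by (simp add: rn_inner_def algebra_simps sum_subtractf sum_distrib_left)
  have sub: "coord.span B \<subseteq> coord.span (insert b B)" by (rule coord.span_mono) auto
  have bspan: "b \<in> coord.span (insert b B)" by (rule coord.span_base) auto
  have "b - b' \<in> coord.span (insert b B)"
    using sub b' bspan by (intro coord.span_diff) auto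
  hence dspan: "d \<in> coord.span (insert b B)" by (simp add: d_def fun_diff_def)
  define y' where "y' = (\<lambda>i. y i + t * d i)"
  have "y + (\<lambda>i. t * d i) \<in> coord.span (insert b B)"
    using sub y dspan by (intro coord.span_add coord.span_scale) auto
  hence y'span: "y' \<in> coord.span (insert b B)" by (simp add: y'_def plus_fun_def)
  have xy': "(\<lambda>i. x i - y' i) = (\<lambda>i. (x i - y i) - t * d i)"
    by (auto simp: y'_def)
  \<comment> \<open>If \<open>b\<close> already lies in the span of \<open>B\<close> then \<open>d\<close> vanishes on \<open>{1..N}\<close> and the division by
    zero makes the coefficient \<open>t\<close> zero, which is the correct value.\<close>
  have "rn_inner N d d = 0 \<Longrightarrow> rn_inner N u d = 0" for u
  proof -
    assume "rn_inner N d d = 0"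
    hence "\<forall>i\<in>{1..N}. d i * d i = 0" unfolding rn_inner_def
      by (subst (asm) sum_nonneg_eq_0_iff) auto
    thus ?thesis by (simp add: rn_inner_def)
  qed
  hence orth_d: "rn_inner N (\<lambda>i. x i - y' i) d = 0"
    unfolding xy' lin2 by (cases "rn_inner N d d = 0") (auto simp: t_def)
  have orth_B: "rn_inner N (\<lambda>i. x i - y' i) z = 0" if "z \<in> coord.span B" for z
    unfolding xy' lin2 using dB[OF that] y(2)[OF that] by simp
  show ?case
  proof (intro bexI[OF _ y'span] ballI)
    fix z assume "z \<in> coord.span (insert b B)"
    then obtain k where k: "z - (\<lambda>i. k * b i) \<in> coord.span B"
      using coord.span_breakdown_eq by blast
    define z0 where "z0 = z - (\<lambda>i. k * b i) + (\<lambda>i. k * b' i)"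
    have z0: "z0 \<in> coord.span B" unfolding z0_def
      using k b' by (intro coord.span_add coord.span_scale)
    have "z = (\<lambda>i. z0 i + k * d i)" by (auto simp: z0_def d_def algebra_simps)
    thus "rn_inner N (\<lambda>i. x i - y' i) z = 0"
      by (simp only: lin1 orth_d orth_B[OF z0])
  qed
qed

lemma orth_proj_eqI:
  assumes "coord.subspace E" "E \<subseteq> rn_space N" "y \<in> E"
    "\<And>z. z \<in> E \<Longrightarrow> rn_inner N (\<lambda>i. x i - y i) z = 0"
  shows "orth_proj N E x = y"
  unfolding orth_proj_def
proof (rule the_equality)
  fix y' assume y': "y' \<in> E \<and> (\<forall>z\<in>E. rn_inner N (\<lambda>i. x i - y' i) z = 0)"
  have "y - y' \<in> E" using assms y' by (intro coord.subspace_diff) auto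
  hence *: "(\<lambda>i. y i - y' i) \<in> E" by (simp add: fun_diff_def)
  have "rn_inner N (\<lambda>i. y i - y' i) (\<lambda>i. y i - y' i)
     = rn_inner N (\<lambda>i. x i - y' i) (\<lambda>i. y i - y' i) - rn_inner N (\<lambda>i. x i - y i) (\<lambda>i. y i - y' i)"
    by (simp add: rn_inner_def algebra_simps flip: sum_subtractf)
  also have "\<dots> = 0" using assms(4)[OF *] y' * by simp
  finally have "\<forall>i\<in>{1..N}. (y i - y' i) * (y i - y' i) = 0" unfolding rn_inner_def
    by (subst (asm) sum_nonneg_eq_0_iff) auto
  moreover have "y i = y' i" if "i \<notin> {1..N}" for i
  proof -
    have "y \<in> rn_space N" "y' \<in> rn_space N" using assms(2,3) y' by auto
    thus ?thesis using that by (simp add: rn_space_def)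
  qed
  ultimately have "y i = y' i" for i by (cases "i \<in> {1..N}") auto
  thus "y' = y" by auto
qed (use assms in auto)

lemma grassmannianD:
  assumes "E \<in> grassmannian N n"
  shows "coord.subspace E" "E \<subseteq> rn_space N" "coord.dim E + n = N"
  using assms by (auto simp: grassmannian_def)

lemma orth_proj_props:
  assumes E: "E \<in> grassmannian N n"
  shows "orth_proj N E x \<in> E" "\<And>z. z \<in> E \<Longrightarrow> rn_inner N (\<lambda>i. x i - orth_proj N E x i) z = 0"
proof -
  note sub = grassmannianD[OF E]
  obtain B where B: "B \<subseteq> E" "coord.independent B" "E \<subseteq> coord.span B" "card B = coord.dim E"
    using coord.basis_exists by blast
  have span: "coord.span B = E" using B sub coord.span_minimal by blast
  have "finite B" using B sub
    by (intro card_independent_supported_on[of "{1..N}"]) (auto simp: rn_space_eq_supported_on)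
  then obtain y where y: "y \<in> E" "\<And>z. z \<in> E \<Longrightarrow> rn_inner N (\<lambda>i. x i - y i) z = 0"
    using orth_proj_exists[of B N x, unfolded span] B(1) sub(2) by blast
  have "orth_proj N E x = y" using sub y by (intro orth_proj_eqI)
  thus "orth_proj N E x \<in> E" "\<And>z. z \<in> E \<Longrightarrow> rn_inner N (\<lambda>i. x i - orth_proj N E x i) z = 0"
    using y by auto
qed

lemma coord_sum_apply: "(\<Sum>i\<in>I. f i) k = (\<Sum>i\<in>I. (f i k :: real))"
  by (induction I rule: infinite_finite_induct) auto

text \<open>
  The orthogonal projection is linear: the combination of the projected unit vectors
  satisfies the equations that characterise the projection of \<open>x\<close>.
\<close>

lemma mat_app_proj_matrix:
  assumes E: "E \<in> grassmannian N n" and x: "x \<in> rn_space N"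
  shows "mat_app N (proj_matrix N E) x = orth_proj N E x"
proof (rule orth_proj_eqI[symmetric, OF grassmannianD(1,2)[OF E]])
  let ?P = "\<lambda>j. orth_proj N E (rn_unit j)"
  have eq: "mat_app N (proj_matrix N E) x = (\<Sum>j\<in>{1..N}. (\<lambda>i. x j * ?P j i))"
  proof
    fix i
    show "mat_app N (proj_matrix N E) x i = (\<Sum>j\<in>{1..N}. (\<lambda>i. x j * ?P j i)) i"
    proof (cases "i \<in> {1..N}")
      case True
      thus ?thesis 
        unfolding mat_app_def coord_sum_apply
        by (auto simp: proj_matrix_def mult.commute intro!: sum.cong)
    next
      case False
      have "?P j i = 0" for j
      proof -
        have "?P j \<in> rn_space N"
          using orth_proj_props(1)[OF E] grassmannianD(2)[OF E] by blast
        thus ?thesis using False by (simp add: rn_space_def)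
      qed
      thus ?thesis unfolding mat_app_def coord_sum_apply if_not_P[OF False] by simp
    qed
  qed
  show "mat_app N (proj_matrix N E) x \<in> E"
    unfolding eq using orth_proj_props(1)[OF E] grassmannianD(1)[OF E]
    by (intro coord.subspace_sum coord.subspace_scale)
  fix z assume z: "z \<in> E"
  have "rn_inner N (\<lambda>i. x i - mat_app N (proj_matrix N E) x i) z
      = (\<Sum>i=1..N. \<Sum>j=1..N. x j * ((rn_unit j i - ?P j i) * z i))"
    unfolding rn_inner_def
  proof (intro sum.cong refl)
    fix i assume i: "i \<in> {1..N}"
    have "(\<Sum>j=1..N. x j * rn_unit j i) = (\<Sum>j\<in>{1..N}. if j = i then x i else 0)"
      by (intro sum.cong) (auto simp: rn_unit_def)
    hence "x i = (\<Sum>j=1..N. x j * rn_unit j i)" using i by simp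
    thus "(x i - mat_app N (proj_matrix N E) x i) * z i = (\<Sum>j=1..N. x j * ((rn_unit j i - ?P j i) * z i))"
      unfolding eq coord_sum_apply
      by (simp add: left_diff_distrib right_diff_distrib sum_subtractf sum_distrib_right mult.assoc)
  qed
  also have "\<dots> = (\<Sum>j=1..N. x j * rn_inner N (\<lambda>i. rn_unit j i - ?P j i) z)"
    by (subst sum.swap) (simp add: rn_inner_def sum_distrib_left)
  also have "\<dots> = 0" using orth_proj_props(2)[OF E z] by simp
  finally show "rn_inner N (\<lambda>i. x i - mat_app N (proj_matrix N E) x i) z = 0" .
qed

text \<open>
  Distance, in the sum norm, of \<open>x\<close> from its image under the projection matrix. Unlike
  membership of \<open>x\<close> in \<open>E\<close>, it is continuous in \<open>x\<close> and in the topology of the Grassmannian.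
\<close>

definition proj_defect :: "nat \<Rightarrow> (nat \<Rightarrow> real) set \<Rightarrow> (nat \<Rightarrow> real) \<Rightarrow> real" where
  "proj_defect N E x = (\<Sum>i=1..N. \<bar>(\<Sum>j=1..N. proj_matrix N E i j * x j) - x i\<bar>)"

lemma proj_defect_nonneg: "proj_defect N E x \<ge> 0"
  by (simp add: proj_defect_def sum_nonneg)

lemma proj_defect_eq_0_iff:
  assumes E: "E \<in> grassmannian N n" and x: "x \<in> rn_space N"
  shows "proj_defect N E x = 0 \<longleftrightarrow> x \<in> E"
proof -
  have "proj_defect N E x = 0 \<longleftrightarrow> (\<forall>i\<in>{1..N}. mat_app N (proj_matrix N E) x i = x i)"
    unfolding proj_defect_def by (subst sum_nonneg_eq_0_iff) (auto simp: mat_app_def)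
  also have "\<dots> \<longleftrightarrow> mat_app N (proj_matrix N E) x = x"
    using x by (auto simp: fun_eq_iff mat_app_def rn_space_def)
  also have "\<dots> \<longleftrightarrow> orth_proj N E x = x" by (simp add: mat_app_proj_matrix[OF E x])
  also have "\<dots> \<longleftrightarrow> x \<in> E"
    using orth_proj_props(1)[OF E, of x] orth_proj_eqI[OF grassmannianD(1,2)[OF E], of x x]
    by (auto simp: rn_inner_def)
  finally show ?thesis .
qed

lemma continuous_on_proj_defect [continuous_intros]: "continuous_on S (proj_defect N E)"
  unfolding proj_defect_def[abs_def] by (intro continuous_intros)

lemma openin_grassmannian_top:
  "openin (grassmannian_top N n) U \<longleftrightarrow> (\<exists>V. open V \<and> U = proj_matrix N -` V \<inter> grassmannian N n)"
  by (simp add: grassmannian_top_def openin_pullback_topology)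

lemma grassmannian_opens_subset: "{U. openin (grassmannian_top N n) U} \<subseteq> Pow (grassmannian N n)"
  by (auto simp: openin_grassmannian_top)

lemma space_grassmannian_borel: "space (grassmannian_borel N n) = grassmannian N n"
  unfolding grassmannian_borel_def by (rule space_measure_of[OF grassmannian_opens_subset])


lemma measurable_proj_matrix [measurable]:
  "(\<lambda>E. proj_matrix N E i j) \<in> borel_measurable (grassmannian_borel N n)"
proof (rule borel_measurableI)
  fix S :: "real set" assume "open S"
  have "continuous_on UNIV (\<lambda>M::nat \<Rightarrow> nat \<Rightarrow> real. M i)"
    by (rule continuous_on_product_coordinates)
  hence "continuous_on UNIV (\<lambda>M::nat \<Rightarrow> nat \<Rightarrow> real. M i j)"
    by (rule continuous_on_product_then_coordinatewise[where f = "\<lambda>M::nat \<Rightarrow> nat \<Rightarrow> real. M i"])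
  hence "open ((\<lambda>M::nat \<Rightarrow> nat \<Rightarrow> real. M i j) -` S)"
    by (rule open_vimage[OF \<open>open S\<close>])
  hence "openin (grassmannian_top N n)
     (proj_matrix N -` ((\<lambda>M. M i j) -` S) \<inter> grassmannian N n)"
    unfolding openin_grassmannian_top by blast
  hence "proj_matrix N -` ((\<lambda>M. M i j) -` S) \<inter> grassmannian N n \<in> sets (grassmannian_borel N n)"
    unfolding grassmannian_borel_def by (subst sets_measure_of[OF grassmannian_opens_subset]) auto
  thus "(\<lambda>E. proj_matrix N E i j) -` S \<inter> space (grassmannian_borel N n)
      \<in> sets (grassmannian_borel N n)"
    by (simp add: space_grassmannian_borel vimage_def)
qed

lemma measurable_proj_defect [measurable]:
  "(\<lambda>E. proj_defect N E x) \<in> borel_measurable (grassmannian_borel N n)"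
  unfolding proj_defect_def
  by (intro borel_measurable_sum borel_measurable_abs borel_measurable_diff borel_measurable_times
        measurable_proj_matrix borel_measurable_const)

text \<open>
  The point ranges over a set that varies with \<open>w\<close>. Writing \<open>x \<in> g w\<close> as the vanishing of the
  projection defect, and \<open>0 < h\<close> as \<open>1/(k+1) \<le> h\<close> for some \<open>k\<close>, turns this into the existence
  of a zero of a nonnegative function on the fixed compact set \<open>K\<close>.
\<close>

lemma sets_Collect_ex_section_point:
  assumes K: "compact K" "K \<subseteq> rn_space N"
    and g: "g \<in> measurable M (grassmannian_borel N n)"
    and meas: "\<And>x. x \<in> K \<Longrightarrow> (\<lambda>w. h w x) \<in> borel_measurable M"
    and cont: "\<And>w. w \<in> space M \<Longrightarrow> continuous_on K (h w)"
  shows "{w \<in> space M. \<exists>x\<in>g w \<inter> K. 0 < (h w x :: real)} \<in> sets M"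
proof -
  have "(\<exists>x\<in>g w \<inter> K. 0 < h w x) \<longleftrightarrow>
      (\<exists>k::nat. \<exists>x\<in>K. proj_defect N (g w) x + max 0 (1 / (real k + 1) - h w x) \<le> 0)"
    if w: "w \<in> space M" for w
  proof -
    have gw: "g w \<in> grassmannian N n"
      using measurable_space[OF g w] by (simp add: space_grassmannian_borel)
    have "(\<exists>x\<in>g w \<inter> K. 0 < h w x) \<longleftrightarrow> (\<exists>x\<in>g w \<inter> K. \<exists>k::nat. 1 / (real k + 1) \<le> h w x)"
    proof (intro bex_cong refl iffI)
      fix x assume "0 < h w x"
      then obtain k :: nat where "1 / (real k + 1) < h w x"
        using nat_approx_posE[of "h w x"] by (metis add.commute of_nat_Suc)
      thus "\<exists>k::nat. 1 / (real k + 1) \<le> h w x" by (auto intro: less_imp_le)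
    next
      fix x assume "\<exists>k::nat. 1 / (real k + 1) \<le> h w x"
      then obtain k :: nat where "1 / (real k + 1) \<le> h w x" ..
      moreover have "0 < 1 / (real k + 1)" by simp
      ultimately show "0 < h w x" by linarith
    qed
    also have "\<dots> \<longleftrightarrow> (\<exists>k::nat. \<exists>x\<in>K. proj_defect N (g w) x = 0 \<and> 1 / (real k + 1) \<le> h w x)"
      using proj_defect_eq_0_iff[OF gw] K(2) by blast
    also have "\<dots> \<longleftrightarrow> (\<exists>k::nat. \<exists>x\<in>K. proj_defect N (g w) x + max 0 (1 / (real k + 1) - h w x) \<le> 0)"
    proof -
      have "proj_defect N (g w) x = 0 \<and> 1 / (real k + 1) \<le> h w x \<longleftrightarrow>
          proj_defect N (g w) x + max 0 (1 / (real k + 1) - h w x) \<le> 0" for x and k :: nat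
        using proj_defect_nonneg[of N "g w" x] by (auto simp: max_def)
      thus ?thesis by simp
    qed
    finally show ?thesis .
  qed
  hence "{w \<in> space M. \<exists>x\<in>g w \<inter> K. 0 < h w x} =
      {w \<in> space M. \<exists>k::nat. \<exists>x\<in>K. proj_defect N (g w) x + max 0 (1 / (real k + 1) - h w x) \<le> 0}"
    by blast
  also have "\<dots> \<in> sets M"
  proof (intro sets.sets_Collect_countable_Ex sets_Collect_ex_zero_on_compact K)
    fix k :: nat and x assume "x \<in> K"
    note [measurable] = meas[OF this] measurable_compose[OF g measurable_proj_defect]
    show "(\<lambda>w. proj_defect N (g w) x + max 0 (1 / (real k + 1) - h w x)) \<in> borel_measurable M"
      by measurable
  next
    fix k :: nat and w assume "w \<in> space M"
    thus "continuous_on K (\<lambda>x. proj_defect N (g w) x + max 0 (1 / (real k + 1) - h w x))"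
      by (intro continuous_intros cont)
  qed
  finally show ?thesis .
qed

text \<open>
  The supremum exceeds \<open>a\<close> exactly if some point of the section has norm greater than \<open>a\<close>.
\<close>

lemma measurable_section_radius:
  assumes K: "compact K" "K \<subseteq> rn_space N" "(\<lambda>_. 0) \<in> K"
  shows "section_radius N K \<in> borel_measurable (grassmannian_borel N n)"
proof (subst borel_measurable_iff_greater, intro allI)
  fix a :: real
  have cont: "continuous_on K (rn_norm N)"
    unfolding L2_set_def by (intro continuous_intros)
  have bdd: "bdd_above (rn_norm N ` (E \<inter> K))" for E
  proof (rule bdd_above_mono)
    show "bdd_above (rn_norm N ` K)"
      using compact_continuous_image[OF cont K(1)]
      by (intro bounded_imp_bdd_above compact_imp_bounded)
    show "rn_norm N ` (E \<inter> K) \<subseteq> rn_norm N ` K" by blast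
  qed
  have "(\<lambda>_. 0) \<in> E" if "E \<in> grassmannian N n" for E
    using coord.subspace_0[OF grassmannianD(1)[OF that]] by (simp add: zero_fun_def)
  hence "a < section_radius N K E \<longleftrightarrow> (\<exists>x\<in>E \<inter> K. 0 < rn_norm N x - a)"
    if "E \<in> grassmannian N n" for E
    unfolding section_radius_def using K(3) bdd that by (subst less_cSUP_iff) auto
  hence "{E \<in> space (grassmannian_borel N n). a < section_radius N K E}
      = {E \<in> space (grassmannian_borel N n). \<exists>x\<in>E \<inter> K. 0 < rn_norm N x - a}"
    unfolding space_grassmannian_borel by blast
  also have "\<dots> \<in> sets (grassmannian_borel N n)"
    by (rule sets_Collect_ex_section_point[OF K(1,2) measurable_ident_sets[OF refl]])
       (use cont in \<open>auto intro!: continuous_intros\<close>)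
  finally show "{E \<in> space (grassmannian_borel N n). a < section_radius N K E}
     \<in> sets (grassmannian_borel N n)" .
qed

lemma compact_ellipsoid:
  assumes "0 < p" and \<sigma>: "\<And>i. i \<in> {1..N} \<Longrightarrow> 0 < \<sigma> i"
  shows "compact (ellipsoid N p \<sigma>)"
    and "x \<in> ellipsoid N p \<sigma> \<Longrightarrow> i \<in> {1..N} \<Longrightarrow> \<bar>x i\<bar> \<le> \<sigma> i"
proof -
  show bound: "\<bar>x i\<bar> \<le> \<sigma> i" if x: "x \<in> ellipsoid N p \<sigma>" and i: "i \<in> {1..N}" for x i
  proof -
    have "(\<bar>x i\<bar> / \<sigma> i) powr p \<le> (\<Sum>i=1..N. (\<bar>x i\<bar> / \<sigma> i) powr p)"
      using i by (intro member_le_sum) auto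
    also have "\<dots> \<le> 1" using x by (simp add: ellipsoid_def)
    finally have "\<not> 1 powr p < (\<bar>x i\<bar> / \<sigma> i) powr p" by simp
    hence "\<bar>x i\<bar> / \<sigma> i \<le> 1"
      using \<open>0 < p\<close> powr_less_mono2[of p 1 "\<bar>x i\<bar> / \<sigma> i"] by linarith
    thus ?thesis using \<sigma>[OF i] by simp
  qed
  have "closed {x. (\<Sum>i=1..N. (\<bar>x i\<bar> / \<sigma> i) powr p) \<le> 1}"
    using assms by (intro closed_Collect_le continuous_intros continuous_on_powr')
      (auto intro!: divide_nonneg_pos simp: less_imp_neq[symmetric])
  moreover have "ellipsoid N p \<sigma>
      = supported_on {1..N} \<inter> {x. (\<Sum>i=1..N. (\<bar>x i\<bar> / \<sigma> i) powr p) \<le> 1}"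
    by (auto simp: ellipsoid_def rn_space_eq_supported_on)
  ultimately have "closed (ellipsoid N p \<sigma>)" by (simp add: closed_Int closed_supported_on)
  moreover have "\<bar>x i\<bar> \<le> (if i \<in> {1..N} then \<sigma> i else 0)" if "x \<in> ellipsoid N p \<sigma>" for x i
    using bound[OF that] that by (auto simp: ellipsoid_def rn_space_def)
  ultimately show "compact (ellipsoid N p \<sigma>)"
    by (rule compact_coordinatewise_bounded)
qed

section \<open>Reflections\<close>

lemma rn_inner_supported_on:
  assumes "I \<subseteq> {1..N}" "x \<in> supported_on I \<or> y \<in> supported_on I"
  shows "rn_inner N x y = (\<Sum>i\<in>I. x i * y i)"
  unfolding rn_inner_def using assms
  by (intro sum.mono_neutral_right) (auto simp: supported_on_def)

lemma unit_sphere_iff_rn_inner: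
  assumes "I \<subseteq> {1..N}"
  shows "x \<in> unit_sphere I \<longleftrightarrow> x \<in> supported_on I \<and> rn_inner N x x = 1"
  using rn_inner_supported_on[OF assms, of x x]
  by (auto simp: unit_sphere_def power2_eq_square)

lemma supported_on_subset_rn_space:
  assumes "I \<subseteq> {1..N}"
  shows "supported_on I \<subseteq> rn_space N"
  using assms by (auto simp: supported_on_def rn_space_def)

text \<open>
  For \<open>v = 0\<close> the division by zero gives 0, so that the reflection matrix below is the
  identity and no case distinction is needed.
\<close>

definition reflection_coeff :: "nat \<Rightarrow> (nat \<Rightarrow> real) \<Rightarrow> real" where
  "reflection_coeff N v = 2 / rn_inner N v v"

definition reflection_mat :: "nat \<Rightarrow> (nat \<Rightarrow> real) \<Rightarrow> nat \<Rightarrow> nat \<Rightarrow> real" where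
  "reflection_mat N v = (\<lambda>i j. (if i = j then 1 else 0) - reflection_coeff N v * v i * v j)"

lemma reflection_coeff_square:
  "(reflection_coeff N v)\<^sup>2 * rn_inner N v v = 2 * reflection_coeff N v"
  by (cases "rn_inner N v v = 0") (auto simp: reflection_coeff_def power2_eq_square)

lemma orthogonal_mat_reflection: "orthogonal_mat N (reflection_mat N v)"
  unfolding orthogonal_mat_def
proof (intro ballI)
  fix i j assume ij: "i \<in> {1..N}" "j \<in> {1..N}"
  let ?c = "reflection_coeff N v"
  let ?d = "\<lambda>k i. if k = i then 1 else (0::real)"
  have pick: "(\<Sum>k=1..N. ?d k l * t k) = t l" if "l \<in> {1..N}" for l and t :: "nat \<Rightarrow> real"
  proof -
    have "(\<Sum>k=1..N. ?d k l * t k) = (\<Sum>k\<in>{1..N}. if k = l then t k else 0)"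
      by (intro sum.cong) auto
    thus ?thesis using that by simp
  qed
  have "(\<Sum>k=1..N. reflection_mat N v k i * reflection_mat N v k j)
     = (\<Sum>k=1..N. ?d k i * ?d k j - ?d k i * (?c * v i * v j) - ?d k j * (?c * v i * v j)
          + v i * v j * ?c\<^sup>2 * (v k * v k))"
    unfolding reflection_mat_def
    by (intro sum.cong) (auto simp: algebra_simps power2_eq_square)
  also have "\<dots> = ?d i j - 2 * (?c * v i * v j) + v i * v j * (?c\<^sup>2 * rn_inner N v v)"
    unfolding sum.distrib sum_subtractf pick[OF ij(1)] pick[OF ij(2)] rn_inner_def
      sum_distrib_left[symmetric] by simp
  also have "\<dots> = ?d i j" unfolding reflection_coeff_square by simp
  finally show "(\<Sum>k=1..N. reflection_mat N v k i * reflection_mat N v k j)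
      = (if i = j then 1 else 0)" .
qed

lemma mat_app_reflection:
  assumes "x \<in> rn_space N" "v \<in> rn_space N"
  shows "mat_app N (reflection_mat N v) x
       = (\<lambda>i. x i - reflection_coeff N v * rn_inner N v x * v i)"
proof
  fix i
  show "mat_app N (reflection_mat N v) x i = x i - reflection_coeff N v * rn_inner N v x * v i"
  proof (cases "i \<in> {1..N}")
    case True
    have "(\<Sum>j=1..N. (if i = j then 1 else 0) * x j) = (\<Sum>j\<in>{1..N}. if i = j then x j else 0)"
      by (intro sum.cong) auto
    also have "\<dots> = x i" using True by simp
    finally have "(\<Sum>j=1..N. (if i = j then 1 else 0) * x j) = x i" .
    moreover have "(\<Sum>j=1..N. reflection_coeff N v * v i * v j * x j)
        = reflection_coeff N v * rn_inner N v x * v i"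
      by (simp add: rn_inner_def sum_distrib_left sum_distrib_right mult_ac)
    ultimately show ?thesis using True
      unfolding mat_app_def reflection_mat_def left_diff_distrib sum_subtractf by simp
  next
    case False
    hence "x i = 0" "v i = 0" using assms by (auto simp: rn_space_def)
    thus ?thesis unfolding mat_app_def if_not_P[OF False] by simp
  qed
qed

lemma coord_linear_mat_app: "coord_linear (mat_app N A)"
  by (intro coord_linearI)
     (auto simp: mat_app_def fun_eq_iff distrib_left sum.distrib sum_distrib_left mult_ac)

lemma mat_app_in_rn_space: "mat_app N A x \<in> rn_space N"
  by (simp add: mat_app_def rn_space_def)

lemma rn_inner_commute: "rn_inner N x y = rn_inner N y x"
  by (simp add: rn_inner_def mult.commute)

lemma rn_inner_minus_scale_left:
  "rn_inner N (\<lambda>i. x i - k * v i) y = rn_inner N x y - k * rn_inner N v y"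
  by (simp add: rn_inner_def algebra_simps sum_subtractf sum_distrib_left)

lemma rn_inner_minus_scale_right:
  "rn_inner N y (\<lambda>i. x i - k * v i) = rn_inner N y x - k * rn_inner N y v"
  by (simp add: rn_inner_def algebra_simps sum_subtractf sum_distrib_left)

lemma reflection_selfadjoint:
  assumes "x \<in> rn_space N" "y \<in> rn_space N" "v \<in> rn_space N"
  shows "rn_inner N (mat_app N (reflection_mat N v) x) y
       = rn_inner N x (mat_app N (reflection_mat N v) y)"
  using assms rn_inner_commute[of N x v]
  by (simp add: mat_app_reflection rn_inner_minus_scale_left rn_inner_minus_scale_right)

lemma reflection_involution:
  assumes x: "x \<in> rn_space N" and v: "v \<in> rn_space N"
  shows "mat_app N (reflection_mat N v) (mat_app N (reflection_mat N v) x) = x"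
proof -
  let ?c = "reflection_coeff N v" and ?t = "rn_inner N v x"
  have "mat_app N (reflection_mat N v) (mat_app N (reflection_mat N v) x)
    = (\<lambda>i. x i - ?c * ?t * v i - ?c * (?t - ?c * ?t * rn_inner N v v) * v i)"
    using mat_app_in_rn_space[of N "reflection_mat N v" x]
    by (simp add: mat_app_reflection[OF _ v] x rn_inner_minus_scale_right)
  also have "\<dots> = (\<lambda>i. x i - (2 * ?c - ?c\<^sup>2 * rn_inner N v v) * ?t * v i)"
    by (auto simp: algebra_simps power2_eq_square)
  also have "\<dots> = x" by (simp add: reflection_coeff_square)
  finally show ?thesis .
qed

text \<open>
  The reflection in the hyperplane orthogonal to \<open>a - b\<close> exchanges \<open>a\<close> and \<open>b\<close> as they have
  the same norm.
\<close>

lemma reflection_swaps: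
  assumes ab: "a \<in> rn_space N" "b \<in> rn_space N" "rn_inner N a a = 1" "rn_inner N b b = 1"
  shows "mat_app N (reflection_mat N (\<lambda>i. a i - b i)) a = b"
proof -
  let ?v = "\<lambda>i. a i - b i"
  have v: "?v \<in> rn_space N" using ab by (auto simp: rn_space_def)
  have vv: "rn_inner N ?v ?v = 2 - 2 * rn_inner N a b"
    and va: "rn_inner N ?v a = 1 - rn_inner N a b"
    using ab(3,4) rn_inner_minus_scale_left[of N a 1 b] rn_inner_minus_scale_right[of N _ a 1 b]
      rn_inner_commute[of N b a] by simp_all
  have eq: "mat_app N (reflection_mat N ?v) a
      = (\<lambda>i. a i - reflection_coeff N ?v * rn_inner N ?v a * (a i - b i))"
    by (rule mat_app_reflection[OF ab(1) v])
  show ?thesis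
  proof (cases "rn_inner N ?v ?v = 0")
    case True
    hence "\<forall>i\<in>{1..N}. (a i - b i) * (a i - b i) = 0"
      unfolding rn_inner_def by (subst (asm) sum_nonneg_eq_0_iff) auto
    hence "a i = b i" for i
      using ab(1,2) by (cases "i \<in> {1..N}") (auto simp: rn_space_def)
    thus ?thesis unfolding eq by auto
  next
    case False
    hence "reflection_coeff N ?v * rn_inner N ?v a = 1"
      unfolding reflection_coeff_def vv va by (simp add: field_simps)
    thus ?thesis unfolding eq by simp
  qed
qed

section \<open>Averaging a direction over the Gaussian measure\<close>

text \<open>
  The event whose probability is averaged over \<open>u\<close>. The two signs of \<open>\<alpha>\<close> and \<open>\<beta>\<close> cover upper
  and lower bounds on the angle between \<open>u\<close> and the section. Quantifying over all unit
  vectors of the section avoids choosing one when the section has dimension greater than 1.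
\<close>

definition directions_bounded ::
  "nat set \<Rightarrow> real \<Rightarrow> real \<Rightarrow> (nat \<Rightarrow> real) \<Rightarrow> (nat \<Rightarrow> real) set \<Rightarrow> bool" where
  "directions_bounded I \<alpha> \<beta> u E \<longleftrightarrow>
     (\<forall>x\<in>E \<inter> unit_sphere I. \<alpha> * \<bar>\<Sum>i\<in>I. x i * u i\<bar> \<le> \<beta> * L2_set u I)"

lemma sets_directions_bounded:
  assumes I: "I \<subseteq> {1..N}" and g: "g \<in> measurable M (grassmannian_borel N n)"
    and u: "\<And>i. i \<in> I \<Longrightarrow> (\<lambda>w. u w i) \<in> borel_measurable M"
  shows "{w \<in> space M. directions_bounded I \<alpha> \<beta> (u w) (g w)} \<in> sets M"
proof -
  have fin: "finite I" using I finite_subset by auto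
  note [measurable] = u
  have "{w \<in> space M. \<exists>x\<in>g w \<inter> unit_sphere I.
           0 < \<alpha> * \<bar>\<Sum>i\<in>I. x i * u w i\<bar> - \<beta> * L2_set (u w) I} \<in> sets M"
  proof (rule sets_Collect_ex_section_point[OF compact_unit_sphere[OF fin] _ g])
    show "unit_sphere I \<subseteq> rn_space N"
      using supported_on_subset_rn_space[OF I] by (auto simp: unit_sphere_def)
    show "(\<lambda>w. \<alpha> * \<bar>\<Sum>i\<in>I. x i * u w i\<bar> - \<beta> * L2_set (u w) I) \<in> borel_measurable M" for x
      unfolding L2_set_def by measurable
    show "continuous_on (unit_sphere I) (\<lambda>x. \<alpha> * \<bar>\<Sum>i\<in>I. x i * u w i\<bar> - \<beta> * L2_set (u w) I)" for w
      by (intro continuous_intros)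
  qed
  hence "space M - {w \<in> space M. \<exists>x\<in>g w \<inter> unit_sphere I.
           0 < \<alpha> * \<bar>\<Sum>i\<in>I. x i * u w i\<bar> - \<beta> * L2_set (u w) I} \<in> sets M"
    by (rule sets.Diff[OF sets.top])
  moreover have "directions_bounded I \<alpha> \<beta> (u w) (g w) \<longleftrightarrow>
      \<not> (\<exists>x\<in>g w \<inter> unit_sphere I. 0 < \<alpha> * \<bar>\<Sum>i\<in>I. x i * u w i\<bar> - \<beta> * L2_set (u w) I)" for w
    by (simp add: directions_bounded_def not_less)
  hence "space M - {w \<in> space M. \<exists>x\<in>g w \<inter> unit_sphere I.
           0 < \<alpha> * \<bar>\<Sum>i\<in>I. x i * u w i\<bar> - \<beta> * L2_set (u w) I}
     = {w \<in> space M. directions_bounded I \<alpha> \<beta> (u w) (g w)}"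
    by blast
  ultimately show ?thesis by simp
qed

text \<open>
  The reflection that exchanges \<open>a\<close> and the normalisation \<open>b\<close> of \<open>u\<close> changes a vector by a
  multiple of \<open>a - b\<close>, so it preserves the subspace of vectors supported on \<open>I\<close>. The
  inner product of \<open>R y\<close> with \<open>b\<close> is that of \<open>y\<close> with \<open>a\<close>.
\<close>

lemma directions_bounded_reflection:
  assumes E: "E \<in> grassmannian N n" and I: "I \<subseteq> {1..N}"
    and a: "a \<in> unit_sphere I" and nz: "L2_set u I \<noteq> 0"
    and bounded: "directions_bounded I \<alpha> \<beta> a E"
  defines "b \<equiv> (\<lambda>i. if i \<in> I then u i / L2_set u I else 0)"
  defines "R \<equiv> mat_app N (reflection_mat N (\<lambda>i. a i - b i))"
  shows "R ` E \<in> grassmannian N n" "directions_bounded I \<alpha> \<beta> u (R ` E)"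
proof -
  have fin: "finite I" using I finite_subset by auto
  have upos: "L2_set u I > 0" using nz L2_set_nonneg[of u I] by linarith
  have "(\<Sum>i\<in>I. (u i)\<^sup>2) = (L2_set u I)\<^sup>2" by (simp add: L2_set_square)
  hence "b \<in> unit_sphere I"
    using nz by (simp add: unit_sphere_def b_def supported_on_def power_divide
        flip: sum_divide_distrib)
  hence ab: "a \<in> supported_on I" "b \<in> supported_on I" "rn_inner N a a = 1" "rn_inner N b b = 1"
    using a unit_sphere_iff_rn_inner[OF I] by auto
  hence abN: "a \<in> rn_space N" "b \<in> rn_space N"
    using supported_on_subset_rn_space[OF I] by auto
  have v: "(\<lambda>i. a i - b i) \<in> rn_space N" using abN by (auto simp: rn_space_def)
  have RR: "R (R x) = x" if "x \<in> rn_space N" for x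
    unfolding R_def using that v by (rule reflection_involution)
  have adj: "rn_inner N (R x) y = rn_inner N x (R y)" if "x \<in> rn_space N" "y \<in> rn_space N" for x y
    unfolding R_def using that v by (rule reflection_selfadjoint)
  have Ra: "R a = b" unfolding R_def by (rule reflection_swaps) (use ab abN in auto)
  show "R ` E \<in> grassmannian N n"
  proof (rule grassmannian_linear_image[OF E])
    show "coord_linear R" unfolding R_def by (rule coord_linear_mat_app)
    show "inj_on R (rn_space N)" using RR by (metis inj_onI)
    show "R ` rn_space N \<subseteq> rn_space N" unfolding R_def using mat_app_in_rn_space by blast
  qed
  show "directions_bounded I \<alpha> \<beta> u (R ` E)"
    unfolding directions_bounded_def
  proof
    fix x assume x: "x \<in> R ` E \<inter> unit_sphere I"
    hence xs: "x \<in> supported_on I" "rn_inner N x x = 1"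
      using unit_sphere_iff_rn_inner[OF I] by auto
    hence xN: "x \<in> rn_space N" using supported_on_subset_rn_space[OF I] by auto
    obtain y where y: "y \<in> E" "x = R y" using x by blast
    have yN: "y \<in> rn_space N" using y grassmannianD(2)[OF E] by auto
    have yx: "y = R x" using RR[OF yN] y by simp
    have "y \<in> supported_on I"
      unfolding yx R_def mat_app_reflection[OF xN v] using xs ab by (auto simp: supported_on_def)
    moreover have "rn_inner N y y = rn_inner N x (R y)"
      by (subst (1) yx, rule adj[OF xN yN])
    ultimately have "y \<in> unit_sphere I" using xs y unit_sphere_iff_rn_inner[OF I] by auto
    hence "\<alpha> * \<bar>\<Sum>i\<in>I. y i * a i\<bar> \<le> \<beta> * L2_set a I"
      using bounded y by (auto simp: directions_bounded_def)
    moreover have "(\<Sum>i\<in>I. y i * a i) = rn_inner N y a"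
      using ab by (intro rn_inner_supported_on[OF I, symmetric]) auto
    moreover have "rn_inner N y a = rn_inner N x b"
      unfolding Ra[symmetric] by (subst yx, rule adj[OF xN abN(1)])
    moreover have "rn_inner N x b = (\<Sum>i\<in>I. x i * b i)"
      using ab by (intro rn_inner_supported_on[OF I]) auto
    moreover have "(\<Sum>i\<in>I. x i * b i) = (\<Sum>i\<in>I. x i * u i) / L2_set u I"
      by (simp add: b_def sum_divide_distrib)
    moreover have "L2_set a I = 1" using a by (simp add: L2_set_def unit_sphere_def)
    ultimately have "\<alpha> * (\<bar>\<Sum>i\<in>I. x i * u i\<bar> / L2_set u I) \<le> \<beta>"
      using upos by (simp add: abs_divide)
    thus "\<alpha> * \<bar>\<Sum>i\<in>I. x i * u i\<bar> \<le> \<beta> * L2_set u I"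
      using upos by (simp add: field_simps)
  qed
qed

lemma exists_unit_vector_in_section:
  assumes E: "E \<in> grassmannian N n" and n: "n < N" and I: "I \<subseteq> {1..N}" "card I = n + 1"
  obtains x where "x \<in> E" "x \<in> unit_sphere I"
proof -
  obtain x where x: "x \<in> E" "x \<in> supported_on I" "x \<noteq> 0"
    using exists_nonzero_supported_on[OF E n I] .
  have fin: "finite I" using I finite_subset by auto
  have "L2_set x I \<noteq> 0"
  proof
    assume "L2_set x I = 0"
    hence "\<forall>i\<in>I. x i = 0" using L2_set_eq_0_iff[OF fin] by blast
    hence "x i = 0" for i using x(2) by (cases "i \<in> I") (auto simp: supported_on_def)
    thus False using x(3) by (auto simp: fun_eq_iff)
  qed
  moreover have "(\<Sum>i\<in>I. (x i)\<^sup>2) = (L2_set x I)\<^sup>2" by (simp add: L2_set_square)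
  ultimately have "(\<lambda>i. (1 / L2_set x I) * x i) \<in> unit_sphere I"
    using x(2) by (simp add: unit_sphere_def supported_on_def power_divide flip: sum_divide_distrib)
  moreover have "(\<lambda>i. (1 / L2_set x I) * x i) \<in> E"
    using coord.subspace_scale[OF grassmannianD(1)[OF E] x(1)] .
  ultimately show ?thesis using that by blast
qed

text \<open>
  The averaging argument. By invariance the event for the direction \<open>a\<close> is at most as likely
  as the event for any vector \<open>u\<close>; integrating over a Gaussian \<open>u\<close> and exchanging the
  integrals leaves, for each \<open>E\<close>, a Gaussian probability that is bounded by looking at a
  single unit vector of the section.
\<close>

lemma measure_directions_bounded_le:
  assumes haar: "haar_grassmannian N n \<mu>" and n: "n < N"
    and I: "I \<subseteq> {1..N}" "card I = n + 1" and a: "a \<in> unit_sphere I" and "0 \<le> b"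
    and gauss: "\<And>x. x \<in> unit_sphere I \<Longrightarrow> measure (gaussian_vector I)
       {u \<in> space (gaussian_vector I). \<alpha> * \<bar>\<Sum>i\<in>I. x i * u i\<bar> \<le> \<beta> * L2_set u I} \<le> b"
  shows "{E \<in> space \<mu>. directions_bounded I \<alpha> \<beta> a E} \<in> sets \<mu>"
    and "measure \<mu> {E \<in> space \<mu>. directions_bounded I \<alpha> \<beta> a E} \<le> b"
proof -
  define \<nu> where "\<nu> = gaussian_vector I"
  have prob: "prob_space \<mu>" and sets: "sets \<mu> = sets (grassmannian_borel N n)"
    and inv: "\<And>A B. orthogonal_mat N A \<Longrightarrow> B \<in> sets \<mu> \<Longrightarrow>
         emeasure \<mu> ((\<lambda>E. mat_app N A ` E) ` B) = emeasure \<mu> B"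
    using haar by (auto simp: haar_grassmannian_def)
  have space: "space \<mu> = grassmannian N n"
    using sets_eq_imp_space_eq[OF sets] by (simp add: space_grassmannian_borel)
  interpret \<mu>: prob_space \<mu> by (rule prob)
  interpret \<nu>: prob_space \<nu> unfolding \<nu>_def by (rule prob_space_gaussian_vector)
  interpret pair_sigma_finite \<mu> \<nu> ..
  have id: "(\<lambda>E. E) \<in> measurable \<mu> (grassmannian_borel N n)"
    using sets by (intro measurable_ident_sets) simp
  define Bad where "Bad u = {E \<in> space \<mu>. directions_bounded I \<alpha> \<beta> u E}" for u
  have Bad_sets: "Bad u \<in> sets \<mu>" for u
    unfolding Bad_def by (rule sets_directions_bounded[OF I(1) id]) simp
  thus "{E \<in> space \<mu>. directions_bounded I \<alpha> \<beta> a E} \<in> sets \<mu>" by (simp add: Bad_def)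
  have mono: "emeasure \<mu> (Bad a) \<le> emeasure \<mu> (Bad u)" for u
  proof (cases "L2_set u I = 0")
    case True
    have "finite I" using I finite_subset by auto
    hence "u i = 0" if "i \<in> I" for i using True that by (simp add: L2_set_eq_0_iff)
    \<comment> \<open>For \<open>u = 0\<close> both sides of the defining inequality vanish.\<close>
    hence "Bad u = space \<mu>" by (auto simp: Bad_def directions_bounded_def True)
    thus ?thesis using Bad_sets by (intro emeasure_mono) (auto simp: Bad_def)
  next
    case False
    define A where "A = reflection_mat N (\<lambda>i. a i - (if i \<in> I then u i / L2_set u I else 0))"
    have "emeasure \<mu> (Bad a) = emeasure \<mu> ((\<lambda>E. mat_app N A ` E) ` Bad a)"
      using inv[OF orthogonal_mat_reflection Bad_sets] by (simp add: A_def)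
    also have "\<dots> \<le> emeasure \<mu> (Bad u)"
    proof (rule emeasure_mono[OF _ Bad_sets], safe)
      fix E assume "E \<in> Bad a"
      hence E: "E \<in> grassmannian N n" "directions_bounded I \<alpha> \<beta> a E"
        by (auto simp: Bad_def space)
      show "mat_app N A ` E \<in> Bad u"
        using directions_bounded_reflection[OF E(1) I(1) a False E(2)]
        by (auto simp: Bad_def space A_def)
    qed
    finally show ?thesis .
  qed
  define X where "X = {w \<in> space (\<mu> \<Otimes>\<^sub>M \<nu>). directions_bounded I \<alpha> \<beta> (snd w) (fst w)}"
  have X: "X \<in> sets (\<mu> \<Otimes>\<^sub>M \<nu>)"
    unfolding X_def
  proof (rule sets_directions_bounded[OF I(1)])
    show "fst \<in> measurable (\<mu> \<Otimes>\<^sub>M \<nu>) (grassmannian_borel N n)"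
      by (rule measurable_compose[OF measurable_fst id])
    show "(\<lambda>w. snd w i) \<in> borel_measurable (\<mu> \<Otimes>\<^sub>M \<nu>)" if "i \<in> I" for i
      using that unfolding \<nu>_def by measurable
  qed
  have "emeasure \<mu> (Bad a) = (\<integral>\<^sup>+u. emeasure \<mu> (Bad a) \<partial>\<nu>)"
    by (simp add: \<nu>.emeasure_space_1)
  also have "\<dots> \<le> (\<integral>\<^sup>+u. emeasure \<mu> ((\<lambda>E. (E, u)) -` X) \<partial>\<nu>)"
  proof (rule nn_integral_mono)
    fix u assume "u \<in> space \<nu>"
    hence "(\<lambda>E. (E, u)) -` X = Bad u" by (auto simp: X_def Bad_def space_pair_measure)
    thus "emeasure \<mu> (Bad a) \<le> emeasure \<mu> ((\<lambda>E. (E, u)) -` X)" using mono by simp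
  qed
  also have "\<dots> = emeasure (\<mu> \<Otimes>\<^sub>M \<nu>) X" by (rule emeasure_pair_measure_alt2[OF X, symmetric])
  also have "\<dots> = (\<integral>\<^sup>+E. emeasure \<nu> (Pair E -` X) \<partial>\<mu>)"
    by (rule \<nu>.emeasure_pair_measure_alt[OF X])
  also have "\<dots> \<le> (\<integral>\<^sup>+E. ennreal b \<partial>\<mu>)"
  proof (rule nn_integral_mono)
    fix E assume E: "E \<in> space \<mu>"
    then obtain x where x: "x \<in> E" "x \<in> unit_sphere I"
      using exists_unit_vector_in_section[OF _ n I, of E] space by auto
    have fin: "finite I" using I finite_subset by auto
    have "{u \<in> space \<nu>. \<alpha> * \<bar>\<Sum>i\<in>I. x i * u i\<bar> \<le> \<beta> * L2_set u I} \<in> sets \<nu>"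
      unfolding \<nu>_def L2_set_def by measurable
    hence "emeasure \<nu> (Pair E -` X)
        \<le> emeasure \<nu> {u \<in> space \<nu>. \<alpha> * \<bar>\<Sum>i\<in>I. x i * u i\<bar> \<le> \<beta> * L2_set u I}"
      using x by (intro emeasure_mono) (auto simp: X_def space_pair_measure directions_bounded_def)
    also have "\<dots> \<le> ennreal b"
      using gauss[OF x(2)] \<open>0 \<le> b\<close> by (simp add: \<nu>.emeasure_eq_measure \<nu>_def[symmetric])
    finally show "emeasure \<nu> (Pair E -` X) \<le> ennreal b" .
  qed
  also have "\<dots> = ennreal b" by (simp add: \<mu>.emeasure_space_1)
  finally show "measure \<mu> {E \<in> space \<mu>. directions_bounded I \<alpha> \<beta> a E} \<le> b"
    using \<open>0 \<le> b\<close> by (simp add: \<mu>.emeasure_eq_measure Bad_def)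
qed

text \<open>
  If \<open>\<bar>\<langle>x,u\<rangle>\<bar> \<le> t \<bar>u\<bar>\<close> then either \<open>\<bar>\<langle>x,u\<rangle>\<bar> \<le> t R\<close> or \<open>\<bar>u\<bar> \<ge> R\<close>. The radius \<open>R\<close> stays free
  because it has to grow with the index in the union bound over all coordinates beyond \<open>n\<close>.
\<close>

lemma gaussian_small_angle:
  assumes "finite I" and x: "x \<in> unit_sphere I" and "0 \<le> t" "0 \<le> R"
  shows "measure (gaussian_vector I)
      {u \<in> space (gaussian_vector I). 1 * \<bar>\<Sum>i\<in>I. x i * u i\<bar> \<le> t * L2_set u I}
    \<le> t * R + exp (real (card I) / 2 - R\<^sup>2 / 4)"
proof -
  interpret prob_space "gaussian_vector I" by (rule prob_space_gaussian_vector)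
  let ?S = "\<lambda>P. {u \<in> space (gaussian_vector I). P u}"
  have unit: "(\<Sum>i\<in>I. (x i)\<^sup>2) = 1" using x by (simp add: unit_sphere_def)
  have [measurable]: "(\<lambda>u. L2_set u I) \<in> borel_measurable (gaussian_vector I)"
    using measurable_L2_set[OF assms(1)] by (simp cong: measurable_cong_sets add: sets_gaussian_vector)
  have "prob (?S (\<lambda>u. 1 * \<bar>\<Sum>i\<in>I. x i * u i\<bar> \<le> t * L2_set u I))
     \<le> prob (?S (\<lambda>u. \<bar>\<Sum>i\<in>I. x i * u i\<bar> \<le> t * R) \<union> ?S (\<lambda>u. R \<le> L2_set u I))"
  proof (rule finite_measure_mono)
    show "?S (\<lambda>u. 1 * \<bar>\<Sum>i\<in>I. x i * u i\<bar> \<le> t * L2_set u I)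
      \<subseteq> ?S (\<lambda>u. \<bar>\<Sum>i\<in>I. x i * u i\<bar> \<le> t * R) \<union> ?S (\<lambda>u. R \<le> L2_set u I)"
    proof safe
      fix u assume u: "1 * \<bar>\<Sum>i\<in>I. x i * u i\<bar> \<le> t * L2_set u I" "\<not> R \<le> L2_set u I"
      have "t * L2_set u I \<le> t * R" using u(2) \<open>0 \<le> t\<close> by (intro mult_left_mono) auto
      thus "\<bar>\<Sum>i\<in>I. x i * u i\<bar> \<le> t * R" using u(1) by simp
    qed
  qed measurable
  also have "\<dots> \<le> prob (?S (\<lambda>u. \<bar>\<Sum>i\<in>I. x i * u i\<bar> \<le> t * R)) + prob (?S (\<lambda>u. R \<le> L2_set u I))"
    by (rule measure_Un_le) measurable
  also have "\<dots> \<le> t * R + exp (real (card I) / 2 - R\<^sup>2 / 4)"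
    using assms unit
    by (intro add_mono gaussian_marginal_small_ball gaussian_vector_norm_upper_tail) auto
  finally show ?thesis .
qed

text \<open>
  If \<open>\<bar>\<langle>x,u\<rangle>\<bar> \<ge> s \<bar>u\<bar>\<close> then either \<open>\<bar>\<langle>x,u\<rangle>\<bar> \<ge> s R\<close> or \<open>\<bar>u\<bar> \<le> R\<close>, here with \<open>R\<^sup>2\<close> equal to a
  third of the dimension.
\<close>

lemma gaussian_large_angle:
  assumes "finite I" and x: "x \<in> unit_sphere I" and "0 \<le> s"
  shows "measure (gaussian_vector I)
      {u \<in> space (gaussian_vector I). (-1) * \<bar>\<Sum>i\<in>I. x i * u i\<bar> \<le> (- s) * L2_set u I}
    \<le> sqrt 2 * exp (- (s\<^sup>2 * real (card I) / 12)) + exp (- real (card I) / 6)"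
proof -
  interpret prob_space "gaussian_vector I" by (rule prob_space_gaussian_vector)
  let ?S = "\<lambda>P. {u \<in> space (gaussian_vector I). P u}"
  define R where "R = sqrt (real (card I) / 3)"
  have unit: "(\<Sum>i\<in>I. (x i)\<^sup>2) = 1" using x by (simp add: unit_sphere_def)
  have [measurable]: "(\<lambda>u. L2_set u I) \<in> borel_measurable (gaussian_vector I)"
    using measurable_L2_set[OF assms(1)] by (simp cong: measurable_cong_sets add: sets_gaussian_vector)
  have "prob (?S (\<lambda>u. (-1) * \<bar>\<Sum>i\<in>I. x i * u i\<bar> \<le> (- s) * L2_set u I))
     \<le> prob (?S (\<lambda>u. s * R \<le> \<bar>\<Sum>i\<in>I. x i * u i\<bar>) \<union> ?S (\<lambda>u. L2_set u I \<le> R))"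
  proof (rule finite_measure_mono)
    show "?S (\<lambda>u. (-1) * \<bar>\<Sum>i\<in>I. x i * u i\<bar> \<le> (- s) * L2_set u I)
      \<subseteq> ?S (\<lambda>u. s * R \<le> \<bar>\<Sum>i\<in>I. x i * u i\<bar>) \<union> ?S (\<lambda>u. L2_set u I \<le> R)"
    proof safe
      fix u assume u: "(-1) * \<bar>\<Sum>i\<in>I. x i * u i\<bar> \<le> (- s) * L2_set u I" "\<not> L2_set u I \<le> R"
      have "s * R \<le> s * L2_set u I" using u(2) \<open>0 \<le> s\<close> by (intro mult_left_mono) auto
      thus "s * R \<le> \<bar>\<Sum>i\<in>I. x i * u i\<bar>" using u(1) by simp
    qed
  qed measurable
  also have "\<dots> \<le> prob (?S (\<lambda>u. s * R \<le> \<bar>\<Sum>i\<in>I. x i * u i\<bar>)) + prob (?S (\<lambda>u. L2_set u I \<le> R))"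
    by (rule measure_Un_le) measurable
  also have "\<dots> \<le> sqrt 2 * exp (- ((s * R)\<^sup>2 / 4)) + exp (- real (card I) / 6)"
    unfolding R_def using assms unit
    by (intro add_mono gaussian_marginal_tail gaussian_vector_norm_lower_tail) auto
  also have "(s * R)\<^sup>2 / 4 = s\<^sup>2 * real (card I) / 12"
    by (simp add: R_def power_mult_distrib)
  finally show ?thesis .
qed

lemma directions_bounded_unit:
  assumes "finite I" "i \<in> I"
  shows "directions_bounded I \<alpha> \<beta> (rn_unit i) E \<longleftrightarrow> (\<forall>x\<in>E \<inter> unit_sphere I. \<alpha> * \<bar>x i\<bar> \<le> \<beta>)"
    and "rn_unit i \<in> unit_sphere I"
proof -
  have "(\<Sum>k\<in>I. x k * rn_unit i k) = x i" for x :: "nat \<Rightarrow> real"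
  proof -
    have "(\<Sum>k\<in>I. x k * rn_unit i k) = (\<Sum>k\<in>I. if k = i then x i else 0)"
      by (intro sum.cong) (auto simp: rn_unit_def)
    thus ?thesis using assms by simp
  qed
  moreover have sq: "(\<Sum>k\<in>I. (rn_unit i k)\<^sup>2) = 1"
  proof -
    have "(\<Sum>k\<in>I. (rn_unit i k)\<^sup>2) = (\<Sum>k\<in>I. if k = i then 1 else 0)"
      by (intro sum.cong) (auto simp: rn_unit_def)
    thus ?thesis using assms by simp
  qed
  ultimately show "directions_bounded I \<alpha> \<beta> (rn_unit i) E \<longleftrightarrow>
      (\<forall>x\<in>E \<inter> unit_sphere I. \<alpha> * \<bar>x i\<bar> \<le> \<beta>)"
    by (simp add: directions_bounded_def L2_set_def)
  show "rn_unit i \<in> unit_sphere I"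
    using sq assms by (auto simp: unit_sphere_def supported_on_def rn_unit_def)
qed

lemma haar_coordinate_small:
  assumes haar: "haar_grassmannian N n \<mu>" and n: "n < N"
    and I: "I \<subseteq> {1..N}" "card I = n + 1" and i: "i \<in> I" and tR: "0 \<le> t" "0 \<le> R"
  shows "{E \<in> space \<mu>. \<forall>x\<in>E \<inter> unit_sphere I. \<bar>x i\<bar> \<le> t} \<in> sets \<mu>"
    and "measure \<mu> {E \<in> space \<mu>. \<forall>x\<in>E \<inter> unit_sphere I. \<bar>x i\<bar> \<le> t}
         \<le> t * R + exp (real (n + 1) / 2 - R\<^sup>2 / 4)"
proof -
  have fin: "finite I" using I finite_subset by auto
  have eq: "{E \<in> space \<mu>. \<forall>x\<in>E \<inter> unit_sphere I. \<bar>x i\<bar> \<le> t}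
      = {E \<in> space \<mu>. directions_bounded I 1 t (rn_unit i) E}"
    using directions_bounded_unit(1)[OF fin i] by simp
  have "0 \<le> t * R + exp (real (n + 1) / 2 - R\<^sup>2 / 4)" using tR by simp
  note * = measure_directions_bounded_le[OF haar n I directions_bounded_unit(2)[OF fin i] this,
      of 1 t, OF gaussian_small_angle[OF fin _ tR, unfolded I(2)]]
  show "{E \<in> space \<mu>. \<forall>x\<in>E \<inter> unit_sphere I. \<bar>x i\<bar> \<le> t} \<in> sets \<mu>"
    unfolding eq by (rule *(1))
  show "measure \<mu> {E \<in> space \<mu>. \<forall>x\<in>E \<inter> unit_sphere I. \<bar>x i\<bar> \<le> t}
         \<le> t * R + exp (real (n + 1) / 2 - R\<^sup>2 / 4)"
    unfolding eq by (rule *(2))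
qed

lemma haar_coordinate_large:
  assumes haar: "haar_grassmannian N n \<mu>" and n: "n < N"
    and I: "I \<subseteq> {1..N}" "card I = n + 1" and i: "i \<in> I" and s: "0 \<le> s"
  shows "{E \<in> space \<mu>. \<forall>x\<in>E \<inter> unit_sphere I. s \<le> \<bar>x i\<bar>} \<in> sets \<mu>"
    and "measure \<mu> {E \<in> space \<mu>. \<forall>x\<in>E \<inter> unit_sphere I. s \<le> \<bar>x i\<bar>}
         \<le> sqrt 2 * exp (- (s\<^sup>2 * real (n + 1) / 12)) + exp (- real (n + 1) / 6)"
proof -
  have fin: "finite I" using I finite_subset by auto
  have eq: "{E \<in> space \<mu>. \<forall>x\<in>E \<inter> unit_sphere I. s \<le> \<bar>x i\<bar>}
      = {E \<in> space \<mu>. directions_bounded I (-1) (-s) (rn_unit i) E}"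
    using directions_bounded_unit(1)[OF fin i] by simp
  have "0 \<le> sqrt 2 * exp (- (s\<^sup>2 * real (n + 1) / 12)) + exp (- real (n + 1) / 6)" by simp
  note * = measure_directions_bounded_le[OF haar n I directions_bounded_unit(2)[OF fin i] this,
      of "-1" "-s", OF gaussian_large_angle[OF fin _ s, unfolded I(2)]]
  show "{E \<in> space \<mu>. \<forall>x\<in>E \<inter> unit_sphere I. s \<le> \<bar>x i\<bar>} \<in> sets \<mu>"
    unfolding eq by (rule *(1))
  show "measure \<mu> {E \<in> space \<mu>. \<forall>x\<in>E \<inter> unit_sphere I. s \<le> \<bar>x i\<bar>}
         \<le> sqrt 2 * exp (- (s\<^sup>2 * real (n + 1) / 12)) + exp (- real (n + 1) / 6)"
    unfolding eq by (rule *(2))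
qed

section \<open>Sections as graphs and the two radius bounds\<close>

text \<open>
  On the coordinates beyond \<open>n\<close> the vectors \<open>w\<^sub>j\<close> look like unit vectors. They are therefore
  independent, and there are \<open>N - n = dim E\<close> of them.
\<close>

lemma grassmannian_graph_representation:
  assumes E: "E \<in> grassmannian N n" and n: "n < N"
    and w: "\<And>j. j \<in> {n+1..N} \<Longrightarrow> w j \<in> E"
      "\<And>j. j \<in> {n+1..N} \<Longrightarrow> w j \<in> supported_on (insert j {1..n})"
      "\<And>j. j \<in> {n+1..N} \<Longrightarrow> w j j = 1"
    and y: "y \<in> E"
  shows "y i = (\<Sum>j=n+1..N. y j * w j i)"
proof -
  let ?J = "{n+1..N}"
  have wjk: "w j k = (if j = k then 1 else 0)" if "j \<in> ?J" "k \<in> ?J" for j k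
    using w(2,3)[OF that(1)] that by (auto simp: supported_on_def)
  have inj: "inj_on w ?J"
  proof
    fix j k assume jk: "j \<in> ?J" "k \<in> ?J" "w j = w k"
    hence "w k j = 1" using wjk[of j j] by simp
    thus "j = k" using wjk[OF jk(2,1)] by (metis zero_neq_one)
  qed
  have eval: "(\<Sum>v\<in>w ` ?J. (\<lambda>i. u v * v i)) k = (\<Sum>j\<in>?J. u (w j) * w j k)" for u k
    unfolding coord_sum_apply by (rule sum.reindex[OF inj, unfolded o_def])
  have eval': "(\<Sum>j\<in>?J. c j * w j k) = c k" if k: "k \<in> ?J" for c k
  proof -
    have "(\<Sum>j\<in>?J. c j * w j k) = (\<Sum>j\<in>?J. if j = k then c k else 0)"
      using wjk k by (intro sum.cong) auto
    thus ?thesis using k by simp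
  qed
  have indep: "coord.independent (w ` ?J)"
  proof
    assume "coord.dependent (w ` ?J)"
    then obtain u v where u: "v \<in> w ` ?J" "u v \<noteq> 0" "(\<Sum>v\<in>w ` ?J. (\<lambda>i. u v * v i)) = 0"
      by (subst (asm) coord.dependent_finite) auto
    then obtain k where k: "k \<in> ?J" "v = w k" by blast
    have "u (w k) = (\<Sum>v\<in>w ` ?J. (\<lambda>i. u v * v i)) k"
      unfolding eval using eval'[OF k(1), of "\<lambda>j. u (w j)"] by simp
    also have "\<dots> = 0" by (simp only: u(3) zero_fun_apply)
    finally show False using u k by simp
  qed
  have "E \<subseteq> coord.span (w ` ?J)"
  proof (rule independent_spans_if_card_eq_dim[OF grassmannianD(2)[OF E] indep])
    show "w ` ?J \<subseteq> E" using w(1) by blast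
    show "card (w ` ?J) = coord.dim E"
      using grassmannianD(3)[OF E] n unfolding card_image[OF inj] by simp
  qed
  hence "y \<in> coord.span (w ` ?J)" using y by blast
  then obtain u where u: "y = (\<Sum>v\<in>w ` ?J. (\<lambda>i. u v * v i))"
    by (subst (asm) coord.span_finite) auto
  have yk: "y k = (\<Sum>j\<in>?J. u (w j) * w j k)" for k unfolding u eval ..
  have "y j = u (w j)" if "j \<in> ?J" for j
    using yk[of j] eval'[OF that, of "\<lambda>j. u (w j)"] by simp
  thus ?thesis using yk[of i] by simp
qed

text \<open>
  Divide the given unit vector of each section by its \<open>j\<close>-th coordinate.
\<close>

lemma transversal_graph_basis:
  assumes E: "E \<in> grassmannian N n" and t: "\<And>j. j \<in> {n+1..N} \<Longrightarrow> 0 < t j"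
    and trans: "\<And>j. j \<in> {n+1..N} \<Longrightarrow> \<exists>x\<in>E \<inter> unit_sphere (insert j {1..n}). t j < \<bar>x j\<bar>"
  obtains w where
    "\<And>j. j \<in> {n+1..N} \<Longrightarrow> w j \<in> E"
    "\<And>j. j \<in> {n+1..N} \<Longrightarrow> w j \<in> supported_on (insert j {1..n})"
    "\<And>j. j \<in> {n+1..N} \<Longrightarrow> w j j = 1"
    "\<And>j. j \<in> {n+1..N} \<Longrightarrow> rn_norm N (w j) \<le> 1 / t j"
proof -
  from trans obtain x where x: "\<And>j. j \<in> {n+1..N} \<Longrightarrow>
      x j \<in> E \<and> x j \<in> unit_sphere (insert j {1..n}) \<and> t j < \<bar>x j j\<bar>"
    by (metis (no_types, lifting) Int_iff)
  define w where "w j = (\<lambda>i. (1 / x j j) * x j i)" for j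
  show ?thesis
  proof
    fix j assume j: "j \<in> {n+1..N}"
    note xj = x[OF j]
    have pos: "0 < \<bar>x j j\<bar>" using t[OF j] xj by linarith
    show "w j \<in> E"
      using xj coord.subspace_scale[OF grassmannianD(1)[OF E], of "x j" "1 / x j j"] by (simp add: w_def)
    show "w j \<in> supported_on (insert j {1..n})"
      using xj by (auto simp: w_def unit_sphere_def supported_on_def)
    show "w j j = 1" using pos by (simp add: w_def)
    have sub: "insert j {1..n} \<subseteq> {1..N}" using j by auto
    have xs: "(\<Sum>i\<in>{1..N}. (x j i)\<^sup>2) = 1"
    proof -
      have "(\<Sum>i\<in>{1..N}. (x j i)\<^sup>2) = (\<Sum>i\<in>insert j {1..n}. (x j i)\<^sup>2)"
        using xj sub by (intro sum.mono_neutral_right) (auto simp: unit_sphere_def supported_on_def)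
      thus ?thesis using xj by (simp add: unit_sphere_def)
    qed
    have "rn_norm N (w j) = 1 / \<bar>x j j\<bar>"
    proof -
      have "(\<Sum>i\<in>{1..N}. (w j i)\<^sup>2) = (\<Sum>i\<in>{1..N}. (x j i)\<^sup>2) / (x j j)\<^sup>2"
        by (simp add: w_def power_divide sum_divide_distrib)
      thus ?thesis unfolding L2_set_def xs by (simp add: real_sqrt_divide)
    qed
    also have "\<dots> \<le> 1 / t j" using xj t[OF j] by (intro divide_left_mono) auto
    finally show "rn_norm N (w j) \<le> 1 / t j" .
  qed
qed

lemma L2_set_sum_le: "L2_set (\<lambda>i. \<Sum>j\<in>J. f j i) A \<le> (\<Sum>j\<in>J. L2_set (f j) A)"
proof (induction J rule: infinite_finite_induct)
  case (insert j J)
  have "L2_set (\<lambda>i. \<Sum>j\<in>insert j J. f j i) A = L2_set (\<lambda>i. f j i + (\<Sum>j\<in>J. f j i)) A"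
    using insert by simp
  also have "\<dots> \<le> L2_set (f j) A + L2_set (\<lambda>i. \<Sum>j\<in>J. f j i) A" by (rule L2_set_triangle_ineq)
  finally show ?case using insert by simp
qed (simp_all add: L2_set_def)

lemma L2_set_scale: "L2_set (\<lambda>i. c * f i) A = \<bar>c\<bar> * L2_set f A"
  by (simp add: L2_set_def power_mult_distrib real_sqrt_mult flip: sum_distrib_left)

lemma section_radius_le:
  assumes E: "E \<in> grassmannian N n" and n: "n < N" and "0 < p"
    and \<sigma>: "\<And>i. i \<in> {1..N} \<Longrightarrow> 0 < \<sigma> i" and t: "\<And>j. j \<in> {n+1..N} \<Longrightarrow> 0 < t j"
    and trans: "\<And>j. j \<in> {n+1..N} \<Longrightarrow> \<exists>x\<in>E \<inter> unit_sphere (insert j {1..n}). t j < \<bar>x j\<bar>"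
  shows "section_radius N (ellipsoid N p \<sigma>) E \<le> (\<Sum>j=n+1..N. \<sigma> j / t j)"
proof -
  obtain w where w: "\<And>j. j \<in> {n+1..N} \<Longrightarrow> w j \<in> E"
    "\<And>j. j \<in> {n+1..N} \<Longrightarrow> w j \<in> supported_on (insert j {1..n})"
    "\<And>j. j \<in> {n+1..N} \<Longrightarrow> w j j = 1"
    "\<And>j. j \<in> {n+1..N} \<Longrightarrow> rn_norm N (w j) \<le> 1 / t j"
    using transversal_graph_basis[OF E t trans] by metis
  show ?thesis unfolding section_radius_def
  proof (rule cSUP_least)
    have "(\<lambda>_. 0) \<in> E" using coord.subspace_0[OF grassmannianD(1)[OF E]] by (simp add: zero_fun_def)
    moreover have "(\<lambda>_. 0) \<in> ellipsoid N p \<sigma>" by (simp add: ellipsoid_def rn_space_def)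
    ultimately show "E \<inter> ellipsoid N p \<sigma> \<noteq> {}" by blast
    fix y assume y: "y \<in> E \<inter> ellipsoid N p \<sigma>"
    have "y = (\<lambda>i. \<Sum>j=n+1..N. y j * w j i)"
      using grassmannian_graph_representation[OF E n w(1-3)] y by blast
    hence "rn_norm N y \<le> (\<Sum>j=n+1..N. L2_set (\<lambda>i. y j * w j i) {1..N})"
      using L2_set_sum_le[of "\<lambda>j i. y j * w j i" "{n+1..N}" "{1..N}"] by simp
    also have "\<dots> = (\<Sum>j=n+1..N. \<bar>y j\<bar> * rn_norm N (w j))" by (simp add: L2_set_scale)
    also have "\<dots> \<le> (\<Sum>j=n+1..N. \<sigma> j * (1 / t j))"
    proof (intro sum_mono mult_mono)
      fix j assume j: "j \<in> {n+1..N}"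
      show "\<bar>y j\<bar> \<le> \<sigma> j" using compact_ellipsoid(2)[of p N \<sigma> y j] \<open>0 < p\<close> \<sigma> y j by auto
      show "0 \<le> \<sigma> j" using \<sigma>[of j] j by auto
    qed (use w(4) in auto)
    finally show "rn_norm N y \<le> (\<Sum>j=n+1..N. \<sigma> j / t j)" by simp
  qed
qed

text \<open>
  All unit vectors of \<open>E \<inter> H\<^sub>n\<^sub>+\<^sub>1\<close> are multiples of \<open>w\<^sub>n\<^sub>+\<^sub>1\<close>, so the flatness assumption, which
  provides a separate vector for each coordinate, holds for all coordinates of one vector
  \<open>x\<close>. The terms \<open>\<bar>\<rho> x\<^sub>i\<bar> / \<sigma>\<^sub>i\<close> are at most 1, and raising them to the power \<open>p \<ge> 1\<close> does not
  increase them, which puts \<open>\<rho> x\<close> into the ellipsoid.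
\<close>

lemma section_radius_ge:
  assumes E: "E \<in> grassmannian N n" and n: "n < N" and p: "1 \<le> p"
    and \<sigma>: "\<And>i. i \<in> {1..N} \<Longrightarrow> 0 < \<sigma> i" and t: "\<And>j. j \<in> {n+1..N} \<Longrightarrow> 0 < t j"
    and trans: "\<And>j. j \<in> {n+1..N} \<Longrightarrow> \<exists>x\<in>E \<inter> unit_sphere (insert j {1..n}). t j < \<bar>x j\<bar>"
    and flat: "\<And>i. i \<in> {1..n+1} \<Longrightarrow> \<exists>x\<in>E \<inter> unit_sphere {1..n+1}. \<bar>x i\<bar> < s i"
    and \<rho>: "0 \<le> \<rho>" "(\<Sum>i=1..n+1. \<rho> * s i / \<sigma> i) \<le> 1"
  shows "\<rho> \<le> section_radius N (ellipsoid N p \<sigma>) E"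
proof -
  obtain w where w: "\<And>j. j \<in> {n+1..N} \<Longrightarrow> w j \<in> E"
    "\<And>j. j \<in> {n+1..N} \<Longrightarrow> w j \<in> supported_on (insert j {1..n})"
    "\<And>j. j \<in> {n+1..N} \<Longrightarrow> w j j = 1"
    using transversal_graph_basis[OF E t trans] by metis
  let ?I = "{1..n+1}"
  have line: "z i = z (n+1) * w (n+1) i" if z: "z \<in> E" "z \<in> supported_on ?I" for z i
  proof -
    have "z i = (\<Sum>j=n+1..N. z j * w j i)"
      by (rule grassmannian_graph_representation[OF E n w z(1)])
    also have "\<dots> = (\<Sum>j\<in>{n+1}. z j * w j i)"
      using z(2) n by (intro sum.mono_neutral_right) (auto simp: supported_on_def)
    finally show ?thesis by simp
  qed
  have same: "\<bar>x i\<bar> = \<bar>z i\<bar>" if x: "x \<in> E" "x \<in> unit_sphere ?I" and z: "z \<in> E" "z \<in> unit_sphere ?I" for x z i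
  proof -
    have unit: "(y (n+1))\<^sup>2 * (\<Sum>i\<in>?I. (w (n+1) i)\<^sup>2) = 1" if y: "y \<in> E" "y \<in> unit_sphere ?I" for y
    proof -
      have "1 = (\<Sum>i\<in>?I. (y i)\<^sup>2)" using y by (simp add: unit_sphere_def)
      also have "\<dots> = (\<Sum>i\<in>?I. (y (n+1))\<^sup>2 * (w (n+1) i)\<^sup>2)"
        using line[OF y(1)] y(2)
        by (intro sum.cong refl) (metis (no_types, lifting) mem_Collect_eq power_mult_distrib unit_sphere_def)
      also have "\<dots> = (y (n+1))\<^sup>2 * (\<Sum>i\<in>?I. (w (n+1) i)\<^sup>2)"
        by (rule sum_distrib_left[symmetric])
      finally show ?thesis ..
    qed
    have "(x (n+1))\<^sup>2 = (z (n+1))\<^sup>2"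
      using unit[OF x] unit[OF z] by (metis mult_cancel_right mult_zero_right zero_neq_one)
    hence "\<bar>x (n+1)\<bar> = \<bar>z (n+1)\<bar>" by (simp add: power2_eq_iff abs_eq_iff)
    thus ?thesis
      using line[OF x(1), of i] line[OF z(1), of i] x z
      by (simp add: unit_sphere_def abs_mult)
  qed
  obtain x where x: "x \<in> E" "x \<in> unit_sphere ?I" using flat[of 1] by auto
  have xs: "\<bar>x i\<bar> < s i" if "i \<in> ?I" for i
    using flat[OF that] same[OF x] by (metis Int_iff)
  have sub: "?I \<subseteq> {1..N}" using n by auto
  define y where "y = (\<lambda>i. \<rho> * x i)"
  have yE: "y \<in> E" unfolding y_def by (rule coord.subspace_scale[OF grassmannianD(1)[OF E] x(1)])
  have y0: "y i = 0" if "i \<notin> ?I" for i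
    using x that by (auto simp: y_def unit_sphere_def supported_on_def)
  have yb: "\<bar>y i\<bar> / \<sigma> i \<le> \<rho> * s i / \<sigma> i" if i: "i \<in> ?I" for i
  proof (rule divide_right_mono)
    show "\<bar>y i\<bar> \<le> \<rho> * s i"
      using xs[OF i] \<rho>(1) by (simp add: y_def abs_mult mult_left_mono)
    show "0 \<le> \<sigma> i" using \<sigma>[of i] i sub by auto
  qed
  have nonneg: "0 \<le> \<rho> * s i / \<sigma> i" if "i \<in> ?I" for i
    using yb[OF that] \<sigma>[of i] that sub by (smt (verit) abs_ge_zero divide_nonneg_pos subsetD)
  have "(\<Sum>i=1..N. (\<bar>y i\<bar> / \<sigma> i) powr p) = (\<Sum>i\<in>?I. (\<bar>y i\<bar> / \<sigma> i) powr p)"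
    using y0 sub by (intro sum.mono_neutral_right) auto
  also have "\<dots> \<le> (\<Sum>i\<in>?I. \<rho> * s i / \<sigma> i)"
  proof (intro sum_mono)
    fix i assume i: "i \<in> ?I"
    have "\<rho> * s i / \<sigma> i \<le> (\<Sum>i\<in>?I. \<rho> * s i / \<sigma> i)"
      using nonneg i by (intro member_le_sum) auto
    hence le1: "\<bar>y i\<bar> / \<sigma> i \<le> 1" using \<rho>(2) yb[OF i] by linarith
    have ge0: "0 \<le> \<bar>y i\<bar> / \<sigma> i" using \<sigma>[of i] i sub by (auto intro!: divide_nonneg_pos)
    have "(\<bar>y i\<bar> / \<sigma> i) powr p \<le> (\<bar>y i\<bar> / \<sigma> i) powr 1"
      using p ge0 le1 by (rule powr_mono')
    thus "(\<bar>y i\<bar> / \<sigma> i) powr p \<le> \<rho> * s i / \<sigma> i"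
      using ge0 yb[OF i] by simp
  qed
  finally have "(\<Sum>i=1..N. (\<bar>y i\<bar> / \<sigma> i) powr p) \<le> 1" using \<rho>(2) by simp
  moreover have "y \<in> rn_space N" using yE grassmannianD(2)[OF E] by blast
  ultimately have yK: "y \<in> ellipsoid N p \<sigma>" by (simp add: ellipsoid_def)
  have "(\<Sum>i\<in>{1..N}. (x i)\<^sup>2) = (\<Sum>i\<in>?I. (x i)\<^sup>2)"
    using x sub by (intro sum.mono_neutral_right) (auto simp: unit_sphere_def supported_on_def)
  hence "rn_norm N x = 1" using x by (simp add: L2_set_def unit_sphere_def)
  hence "rn_norm N y = \<rho>" using \<rho>(1) by (simp add: y_def L2_set_scale)
  moreover have "bdd_above (rn_norm N ` (E \<inter> ellipsoid N p \<sigma>))"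
  proof (rule bdd_aboveI2)
    fix z assume z: "z \<in> E \<inter> ellipsoid N p \<sigma>"
    have "rn_norm N z \<le> (\<Sum>i=1..N. \<bar>z i\<bar>)" by (rule L2_set_le_sum_abs)
    also have "\<dots> \<le> (\<Sum>i=1..N. \<sigma> i)"
      using z compact_ellipsoid(2)[of p N \<sigma> z] p \<sigma> by (intro sum_mono) auto
    finally show "rn_norm N z \<le> (\<Sum>i=1..N. \<sigma> i)" .
  qed
  ultimately show ?thesis
    unfolding section_radius_def using yE yK by (metis IntI cSUP_upper)
qed

section \<open>Summing the failure probabilities and the radius bounds\<close>

lemma geometric_sum_le:
  fixes r :: real
  assumes "0 \<le> r" "r < 1"
  shows "(\<Sum>k<K. r ^ k) \<le> 1 / (1 - r)"
  using sum_le_suminf[OF summable_geometric[of r], of "{..<K}"] suminf_geometric[of r] assms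
  by simp

lemma geometric_deriv_sum_le:
  fixes r :: real
  assumes "0 \<le> r" "r < 1"
  shows "(\<Sum>k<K. (real k + 1) * r ^ k) \<le> 1 / (1 - r)\<^sup>2"
proof -
  have *: "(\<lambda>k. (real k + 1) * r ^ k) sums (1 / (1 - r)\<^sup>2)"
    using geometric_deriv_sums[of r] assms by (simp add: add.commute)
  show ?thesis
    using sum_le_suminf[OF sums_summable[OF *], of "{..<K}"] sums_unique[OF *] assms by simp
qed

lemma sum_shift_tail:
  fixes n N :: nat
  assumes "n < N"
  shows "(\<Sum>j=n+1..N. f (j - (n+1))) = (\<Sum>k<N-n. (f k :: real))"
  by (rule sum.reindex_bij_witness[of _ "\<lambda>k. k + (n+1)" "\<lambda>j. j - (n+1)"]) (use assms in auto)

lemma sum_reverse_head: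
  fixes n :: nat
  shows "(\<Sum>i=1..n+1. f (n+1-i)) = (\<Sum>k<n+1. (f k :: real))"
  by (rule sum.reindex_bij_witness[of _ "\<lambda>k. n+1-k" "\<lambda>i. n+1-i"]) auto

text \<open>
  The required size of the last coordinate in the \<open>k\<close>-th section. With \<open>R\<^sub>k\<close> denoting the
  square root in the denominator, \<open>level \<cdot> R\<^sub>k = \<delta> (1 - r) r\<^sup>k\<close> sums to at most \<open>\<delta>\<close>, and \<open>R\<^sub>k\<close>
  grows so fast that the probabilities of Gaussian norms beyond \<open>R\<^sub>k\<close> are summable too.
\<close>

definition transversality_level :: "nat \<Rightarrow> real \<Rightarrow> real \<Rightarrow> nat \<Rightarrow> real" where
  "transversality_level n \<delta> r k = \<delta> * (1 - r) * r ^ k / sqrt (real (n + 1) * (6 + 4 * real k))"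

text \<open>
  The factor \<open>k + 1\<close> makes the bound on the Gaussian tail at this level equal to \<open>sqrt 2 \<delta>\<^bsup>2(k+1)\<^esup>\<close>, which
  is summable in \<open>k\<close> with a small sum.
\<close>

definition flatness_level :: "nat \<Rightarrow> real \<Rightarrow> nat \<Rightarrow> real" where
  "flatness_level n \<delta> k = sqrt (24 * (real k + 1) * ln (1 / \<delta>) / real (n + 1))"

lemma transversality_failure:
  assumes haar: "haar_grassmannian N n \<mu>" and n: "n < N" and \<delta>: "0 < \<delta>" and r: "0 < r" "r < 1"
  defines "Bad \<equiv> \<lambda>j. {E \<in> space \<mu>. \<forall>x\<in>E \<inter> unit_sphere (insert j {1..n}).
      \<bar>x j\<bar> \<le> transversality_level n \<delta> r (j - (n+1))}"
  shows "\<And>j. j \<in> {n+1..N} \<Longrightarrow> Bad j \<in> sets \<mu>"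
    and "measure \<mu> (\<Union>j\<in>{n+1..N}. Bad j) \<le> \<delta> + 2 * exp (- real (n + 1))"
proof -
  let ?m = "real (n + 1)"
  let ?t = "transversality_level n \<delta> r"
  define R where "R k = sqrt (?m * (6 + 4 * real k))" for k :: nat
  have R: "R k > 0" for k by (simp add: R_def)
  have t: "?t k * R k = \<delta> * ((1 - r) * r ^ k)" "0 \<le> ?t k" for k
    using R[of k] \<delta> r unfolding transversality_level_def R_def[symmetric] by auto
  \<comment> \<open>The constants 6 and 4 in \<open>R\<^sub>k\<close> are chosen such that the exponent becomes \<open>- m (1 + k)\<close>.\<close>
  have tail: "exp (?m / 2 - (R k)\<^sup>2 / 4) \<le> exp (- ?m) * (1 / 2) ^ k" for k
  proof -
    have "?m / 2 - (R k)\<^sup>2 / 4 = - ?m - ?m * real k" by (simp add: R_def algebra_simps)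
    also have "\<dots> \<le> - ?m - real k" by (simp add: algebra_simps)
    finally have "exp (?m / 2 - (R k)\<^sup>2 / 4) \<le> exp (- ?m - real k)" by simp
    also have "\<dots> = exp (- ?m) * exp (-1) ^ k"
      by (simp add: exp_diff exp_minus exp_add field_simps flip: exp_of_nat_mult)
    also have "exp (-1 :: real) \<le> 1 / 2"
      using exp_ge_add_one_self[of "1::real"] by (simp add: exp_minus field_simps)
    hence "exp (- ?m) * exp (-1) ^ k \<le> exp (- ?m) * (1 / 2) ^ k"
      by (intro mult_left_mono power_mono) auto
    finally show ?thesis .
  qed
  have bad: "Bad j \<in> sets \<mu>"
      "measure \<mu> (Bad j) \<le> \<delta> * ((1 - r) * r ^ (j - (n+1))) + exp (- ?m) * (1 / 2) ^ (j - (n+1))"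
    if j: "j \<in> {n+1..N}" for j
  proof -
    let ?k = "j - (n+1)"
    have I: "insert j {1..n} \<subseteq> {1..N}" "card (insert j {1..n}) = n + 1" "j \<in> insert j {1..n}"
      using j by auto
    note * = haar_coordinate_small[OF haar n I t(2)[of ?k] less_imp_le[OF R[of ?k]]]
    show "Bad j \<in> sets \<mu>" unfolding Bad_def by (rule *(1))
    show "measure \<mu> (Bad j) \<le> \<delta> * ((1 - r) * r ^ ?k) + exp (- ?m) * (1 / 2) ^ ?k"
      using *(2) tail[of ?k] unfolding Bad_def t(1) by linarith
  qed
  show "\<And>j. j \<in> {n+1..N} \<Longrightarrow> Bad j \<in> sets \<mu>" by (rule bad(1))
  have "measure \<mu> (\<Union>j\<in>{n+1..N}. Bad j) \<le> (\<Sum>j=n+1..N. measure \<mu> (Bad j))"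
    using bad(1) by (intro measure_UNION_le) auto
  also have "\<dots> \<le> (\<Sum>j=n+1..N. \<delta> * ((1 - r) * r ^ (j - (n+1))) + exp (- ?m) * (1 / 2) ^ (j - (n+1)))"
    by (intro sum_mono bad(2))
  also have "\<dots> = (\<Sum>k<N-n. \<delta> * ((1 - r) * r ^ k) + exp (- ?m) * (1 / 2) ^ k)"
    by (rule sum_shift_tail[OF n, of "\<lambda>k. \<delta> * ((1 - r) * r ^ k) + exp (- ?m) * (1 / 2) ^ k"])
  also have "\<dots> = \<delta> * ((1 - r) * (\<Sum>k<N-n. r ^ k)) + exp (- ?m) * (\<Sum>k<N-n. (1 / 2) ^ k)"
    by (simp only: sum.distrib sum_distrib_left)
  also have "\<dots> \<le> \<delta> * ((1 - r) * (1 / (1 - r))) + exp (- ?m) * (1 / (1 - 1 / 2))"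
    using \<delta> r geometric_sum_le[of r "N-n"] geometric_sum_le[of "1/2" "N-n"]
    by (intro add_mono mult_left_mono) auto
  also have "\<dots> = \<delta> + 2 * exp (- ?m)" using r by simp
  finally show "measure \<mu> (\<Union>j\<in>{n+1..N}. Bad j) \<le> \<delta> + 2 * exp (- ?m)" .
qed

lemma flatness_failure:
  assumes haar: "haar_grassmannian N n \<mu>" and n: "n < N" and \<delta>: "0 < \<delta>" "\<delta> \<le> 1 / 3"
  defines "Bad \<equiv> \<lambda>i. {E \<in> space \<mu>. \<forall>x\<in>E \<inter> unit_sphere {1..n+1}.
      flatness_level n \<delta> (n+1-i) \<le> \<bar>x i\<bar>}"
  shows "\<And>i. i \<in> {1..n+1} \<Longrightarrow> Bad i \<in> sets \<mu>"
    and "measure \<mu> (\<Union>i\<in>{1..n+1}. Bad i) \<le> \<delta> + real (n + 1) * exp (- real (n + 1) / 6)"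
proof -
  let ?m = "real (n + 1)"
  let ?s = "flatness_level n \<delta>"
  have L: "0 \<le> ln (1 / \<delta>)" using \<delta> by simp
  have s: "0 \<le> ?s k" "(?s k)\<^sup>2 * ?m / 12 = 2 * (real k + 1) * ln (1 / \<delta>)" for k
  proof -
    have ge: "0 \<le> 24 * (real k + 1) * ln (1 / \<delta>) / ?m" using L by simp
    thus "0 \<le> ?s k" by (simp add: flatness_level_def)
    show "(?s k)\<^sup>2 * ?m / 12 = 2 * (real k + 1) * ln (1 / \<delta>)"
      unfolding flatness_level_def using ge by (simp add: field_simps)
  qed
  have tail: "sqrt 2 * exp (- ((?s k)\<^sup>2 * ?m / 12)) \<le> sqrt 2 / 3 * (\<delta> * (1 / 3) ^ k)" for k
  proof -
    have "exp (- ((?s k)\<^sup>2 * ?m / 12)) = exp (real (2 * k + 2) * ln \<delta>)"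
      unfolding s(2) using \<delta> by (simp add: ln_div algebra_simps)
    also have "\<dots> = \<delta> ^ (2 * k + 2)"
      using \<delta> unfolding exp_of_nat_mult by simp
    also have "\<dots> = \<delta> * \<delta> ^ (2 * k + 1)" by simp
    also have "\<dots> \<le> \<delta> * (1 / 3) ^ (k + 1)"
    proof (intro mult_left_mono)
      have "\<delta> ^ (2 * k + 1) \<le> \<delta> ^ (k + 1)" using \<delta> by (intro power_decreasing) auto
      also have "\<dots> \<le> (1 / 3) ^ (k + 1)" using \<delta> by (intro power_mono) auto
      finally show "\<delta> ^ (2 * k + 1) \<le> (1 / 3) ^ (k + 1)" .
    qed (use \<delta> in auto)
    finally have "sqrt 2 * exp (- ((?s k)\<^sup>2 * ?m / 12)) \<le> sqrt 2 * (\<delta> * (1 / 3) ^ (k + 1))"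
      by (intro mult_left_mono) auto
    thus ?thesis by simp
  qed
  have bad: "Bad i \<in> sets \<mu>"
      "measure \<mu> (Bad i) \<le> sqrt 2 / 3 * (\<delta> * (1 / 3) ^ (n+1-i)) + exp (- ?m / 6)"
    if i: "i \<in> {1..n+1}" for i
  proof -
    have I: "{1..n+1} \<subseteq> {1..N}" "card {1..n+1} = n + 1" using n by auto
    note * = haar_coordinate_large[OF haar n I i s(1)[of "n+1-i"]]
    show "Bad i \<in> sets \<mu>" unfolding Bad_def by (rule *(1))
    show "measure \<mu> (Bad i) \<le> sqrt 2 / 3 * (\<delta> * (1 / 3) ^ (n+1-i)) + exp (- ?m / 6)"
      using *(2) tail[of "n+1-i"] unfolding Bad_def by linarith
  qed
  show "\<And>i. i \<in> {1..n+1} \<Longrightarrow> Bad i \<in> sets \<mu>" by (rule bad(1))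
  have "measure \<mu> (\<Union>i\<in>{1..n+1}. Bad i) \<le> (\<Sum>i=1..n+1. measure \<mu> (Bad i))"
    using bad(1) by (intro measure_UNION_le) auto
  also have "\<dots> \<le> (\<Sum>i=1..n+1. sqrt 2 / 3 * (\<delta> * (1 / 3) ^ (n+1-i)) + exp (- ?m / 6))"
    by (intro sum_mono bad(2))
  also have "\<dots> = (\<Sum>k<n+1. sqrt 2 / 3 * (\<delta> * (1 / 3) ^ k) + exp (- ?m / 6))"
    by (rule sum_reverse_head[of "\<lambda>k. sqrt 2 / 3 * (\<delta> * (1 / 3) ^ k) + exp (- ?m / 6)"])
  also have "\<dots> = sqrt 2 / 3 * (\<delta> * (\<Sum>k<n+1. (1 / 3) ^ k)) + ?m * exp (- ?m / 6)"
    by (simp only: sum.distrib sum_distrib_left sum_constant card_lessThan)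
  also have "\<dots> \<le> sqrt 2 / 3 * (\<delta> * (1 / (1 - 1 / 3))) + ?m * exp (- ?m / 6)"
    using \<delta> geometric_sum_le[of "1/3" "n+1"] by (intro add_mono mult_left_mono) auto
  also have "\<dots> = (sqrt 2 / 2) * \<delta> + ?m * exp (- ?m / 6)" by simp
  also have "\<dots> \<le> 1 * \<delta> + ?m * exp (- ?m / 6)"
    using \<delta> sqrt2_less_2 by (intro add_mono mult_right_mono) auto
  finally show "measure \<mu> (\<Union>i\<in>{1..n+1}. Bad i) \<le> \<delta> + ?m * exp (- ?m / 6)" by simp
qed

text \<open>
  For \<open>n \<ge> 24\<close> half of the exponent \<open>n/6\<close> absorbs the factor 4.
\<close>

lemma exponential_failure_le:
  assumes "24 \<le> n"
  shows "2 * exp (- real (n + 1)) + real (n + 1) * exp (- real (n + 1) / 6)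
     \<le> real n * exp (- (1 / 12) * real n)"
proof -
  have "2 * exp (- real (n + 1)) + real (n + 1) * exp (- real (n + 1) / 6)
      \<le> (2 * real n) * exp (- real n / 6) + (2 * real n) * exp (- real n / 6)"
    using assms by (intro add_mono mult_mono) auto
  also have "\<dots> = 4 * real n * (exp (- real n / 12) * exp (- real n / 12))"
    by (simp flip: exp_add)
  also have "exp (- real n / 12) \<le> 1 / 4"
  proof -
    have "4 = (2::real)\<^sup>2" by simp
    also have "\<dots> \<le> (exp 1)\<^sup>2" using exp_ge_add_one_self[of "1::real"] by (intro power_mono) auto
    also have "\<dots> = exp 2" by (simp flip: exp_double)
    also have "\<dots> \<le> exp (real n / 12)" using assms by simp
    finally show ?thesis by (simp add: exp_minus field_simps)
  qed
  hence "4 * real n * (exp (- real n / 12) * exp (- real n / 12))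
      \<le> 4 * real n * (1 / 4 * exp (- real n / 12))"
    by (intro mult_left_mono mult_right_mono) auto
  finally show ?thesis by simp
qed

text \<open>
  One factor \<open>r\<^sup>k\<close> of \<open>\<sigma>\<^sub>j = \<sigma>\<^sub>n\<^sub>+\<^sub>1 r\<^bsup>2k\<^esup>\<close> cancels against the level; the other one makes the sum
  of the remaining terms \<open>(k + 1) r\<^sup>k\<close> converge.
\<close>

lemma upper_radius_sum_le:
  assumes n: "1 \<le> n" "n < N" and \<delta>: "0 < \<delta>" and r: "0 < r" "r < 1" and "0 < \<sigma> (n+1)"
    and \<sigma>: "\<And>j. j \<in> {n+1..N} \<Longrightarrow> \<sigma> j = \<sigma> (n+1) * (r\<^sup>2) ^ (j - (n+1))"
  shows "(\<Sum>j=n+1..N. \<sigma> j / transversality_level n \<delta> r (j - (n+1)))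
     \<le> 5 / (1 - r) ^ 3 * (1 / \<delta>) * sqrt (real n) * \<sigma> (n+1)"
proof -
  let ?m = "real (n + 1)"
  let ?c = "\<sigma> (n+1) * (3 * sqrt ?m) / (\<delta> * (1 - r))"
  have "(\<Sum>j=n+1..N. \<sigma> j / transversality_level n \<delta> r (j - (n+1)))
      \<le> (\<Sum>j=n+1..N. ?c * ((real (j - (n+1)) + 1) * r ^ (j - (n+1))))"
  proof (rule sum_mono)
    fix j assume j: "j \<in> {n+1..N}"
    let ?k = "j - (n+1)"
    have "6 + 4 * real ?k \<le> (3 * (real ?k + 1))\<^sup>2"
      by (simp add: power2_eq_square algebra_simps)
    hence "sqrt (6 + 4 * real ?k) \<le> 3 * (real ?k + 1)" by (intro real_le_lsqrt) auto
    hence sq: "sqrt (?m * (6 + 4 * real ?k)) \<le> 3 * sqrt ?m * (real ?k + 1)"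
      by (simp add: real_sqrt_mult mult_left_mono mult.left_commute)
    have "\<sigma> j / transversality_level n \<delta> r ?k
        = \<sigma> (n+1) * r ^ ?k / (\<delta> * (1 - r)) * sqrt (?m * (6 + 4 * real ?k))"
    proof -
      have "\<sigma> j = \<sigma> (n+1) * (r ^ ?k * r ^ ?k)"
        using \<sigma>[OF j] by (simp add: power2_eq_square power_mult_distrib)
      thus ?thesis using r by (simp add: transversality_level_def)
    qed
    also have "\<dots> \<le> \<sigma> (n+1) * r ^ ?k / (\<delta> * (1 - r)) * (3 * sqrt ?m * (real ?k + 1))"
      using r \<delta> \<open>0 < \<sigma> (n+1)\<close> by (intro mult_left_mono[OF sq]) auto
    also have "\<dots> = ?c * ((real ?k + 1) * r ^ ?k)" by simp
    finally show "\<sigma> j / transversality_level n \<delta> r ?k \<le> ?c * ((real ?k + 1) * r ^ ?k)" .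
  qed
  also have "\<dots> = ?c * (\<Sum>k<N-n. (real k + 1) * r ^ k)"
    unfolding sum_distrib_left by (rule sum_shift_tail[OF n(2), of "\<lambda>k. ?c * ((real k + 1) * r ^ k)"])
  also have "\<dots> \<le> ?c * (1 / (1 - r)\<^sup>2)"
    using r \<delta> \<open>0 < \<sigma> (n+1)\<close> by (intro mult_left_mono geometric_deriv_sum_le) auto
  also have "\<dots> = (3 * sqrt ?m) * (\<sigma> (n+1) / (\<delta> * (1 - r) ^ 3))"
    by (simp add: power2_eq_square power3_eq_cube mult_ac)
  also have "\<dots> \<le> (5 * sqrt (real n)) * (\<sigma> (n+1) / (\<delta> * (1 - r) ^ 3))"
  proof (intro mult_right_mono)
    have "3 * sqrt ?m = sqrt (9 * ?m)" unfolding real_sqrt_mult by simp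
    also have "\<dots> \<le> sqrt (25 * real n)" using n(1) by (intro real_sqrt_le_mono) simp
    also have "\<dots> = 5 * sqrt (real n)" by (simp add: real_sqrt_mult)
    finally show "3 * sqrt ?m \<le> 5 * sqrt (real n)" .
  qed (use r \<delta> \<open>0 < \<sigma> (n+1)\<close> in auto)
  finally show ?thesis by (simp add: mult_ac)
qed

lemma lower_radius_sum_le:
  assumes n: "1 \<le> n" and \<delta>: "0 < \<delta>" "\<delta> < 1" and q: "0 < q" "q < 1" and "0 < \<sigma> (n+1)"
    and \<sigma>: "\<And>i. i \<in> {1..n+1} \<Longrightarrow> \<sigma> (n+1) = \<sigma> i * q ^ (n+1-i)"
    and C: "5 / (1 - q)\<^sup>2 \<le> C"
  shows "(\<Sum>i=1..n+1. 1 / (C * sqrt (ln (1 / \<delta>))) * sqrt (real n) * \<sigma> (n+1)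
            * flatness_level n \<delta> (n+1-i) / \<sigma> i) \<le> 1"
proof -
  define L where "L = ln (1 / \<delta>)"
  have L: "0 < L" using \<delta> by (simp add: L_def)
  have "0 < 5 / (1 - q)\<^sup>2" using q by simp
  hence C0: "0 < C" using C by linarith
  have "(\<Sum>i=1..n+1. 1 / (C * sqrt L) * sqrt (real n) * \<sigma> (n+1) * flatness_level n \<delta> (n+1-i) / \<sigma> i)
     \<le> (\<Sum>i=1..n+1. 5 / C * ((real (n+1-i) + 1) * q ^ (n+1-i)))"
  proof (rule sum_mono)
    fix i assume i: "i \<in> {1..n+1}"
    let ?k = "n+1-i"
    have ratio: "\<sigma> (n+1) / \<sigma> i = q ^ ?k"
      using \<sigma>[OF i] \<open>0 < \<sigma> (n+1)\<close> by (cases "\<sigma> i = 0") auto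
    have "real n * (24 * (real ?k + 1) * L / real (n + 1)) \<le> 25 * L * (real ?k + 1)\<^sup>2"
    proof -
      have "real n / real (n + 1) \<le> 1" by simp
      hence "real n / real (n + 1) * (24 * (real ?k + 1) * L) \<le> 1 * (24 * (real ?k + 1) * L)"
        using L by (intro mult_right_mono) auto
      also have "\<dots> \<le> 25 * L * (real ?k + 1)\<^sup>2"
      proof -
        have "24 * (real ?k + 1) \<le> 25 * (real ?k + 1)\<^sup>2"
          by (simp add: power2_eq_square algebra_simps)
        from mult_right_mono[OF this less_imp_le[OF L]] show ?thesis by (simp add: mult_ac)
      qed
      finally show ?thesis by (simp add: mult_ac)
    qed
    hence "sqrt (real n * (24 * (real ?k + 1) * L / real (n + 1))) \<le> sqrt (25 * L * (real ?k + 1)\<^sup>2)"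
      by (rule real_sqrt_le_mono)
    also have "\<dots> = 5 * sqrt L * (real ?k + 1)" by (simp add: real_sqrt_mult)
    finally have fl: "sqrt (real n) * flatness_level n \<delta> ?k \<le> 5 * sqrt L * (real ?k + 1)"
      by (simp only: flatness_level_def L_def[symmetric] real_sqrt_mult[symmetric])
    have "1 / (C * sqrt L) * sqrt (real n) * \<sigma> (n+1) * flatness_level n \<delta> ?k / \<sigma> i
        = 1 / (C * sqrt L) * (sqrt (real n) * flatness_level n \<delta> ?k) * (\<sigma> (n+1) / \<sigma> i)"
      by simp
    also have "\<dots> \<le> 1 / (C * sqrt L) * (5 * sqrt L * (real ?k + 1)) * q ^ ?k"
      unfolding ratio using fl L C0 q by (intro mult_right_mono mult_left_mono) auto
    also have "\<dots> = 5 / C * ((real ?k + 1) * q ^ ?k)" using L by simp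
    finally show "1 / (C * sqrt L) * sqrt (real n) * \<sigma> (n+1) * flatness_level n \<delta> ?k / \<sigma> i
        \<le> 5 / C * ((real ?k + 1) * q ^ ?k)" .
  qed
  also have "\<dots> = 5 / C * (\<Sum>k<n+1. (real k + 1) * q ^ k)"
    unfolding sum_distrib_left by (rule sum_reverse_head[of "\<lambda>k. 5 / C * ((real k + 1) * q ^ k)"])
  also have "\<dots> \<le> 5 / C * (1 / (1 - q)\<^sup>2)"
    using C0 q by (intro mult_left_mono geometric_deriv_sum_le) auto
  also have "\<dots> = (5 / (1 - q)\<^sup>2) / C" by simp
  also have "\<dots> \<le> 1" by (subst pos_divide_le_eq[OF C0]) (use C in simp)
  finally show ?thesis by (simp add: L_def)
qed

text \<open>
  Outside the two unions of bad events both radius bounds hold. The condition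
  \<open>24 ln (1/\<delta>) \<le> n\<close> together with \<open>\<delta> \<le> 1/3\<close> forces \<open>n \<ge> 24\<close>, as \<open>ln 3 \<ge> 1\<close>.
\<close>

lemma section_radius_bounds_probability:
  fixes p q \<delta> :: real and \<sigma> :: "nat \<Rightarrow> real"
  assumes p: "1 < p" and q: "0 < q" "q < 1"
    and \<sigma>1: "0 < \<sigma> 1" and \<sigma>: "\<And>j. j \<in> {1..N} \<Longrightarrow> \<sigma> j = \<sigma> 1 * q ^ (j - 1)"
    and \<delta>: "0 < \<delta>" "\<delta> \<le> 1 / 3" and n: "24 * ln (1 / \<delta>) \<le> real n" "n < N"
    and haar: "haar_grassmannian N n \<mu>"
  defines "C \<equiv> 5 / (1 - sqrt q) ^ 3 + 5 / (1 - q)\<^sup>2"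
  shows "\<P>(E in \<mu>.
      1 / (C * sqrt (ln (1 / \<delta>))) * sqrt (real n) * \<sigma> (n + 1) \<le> section_radius N (ellipsoid N p \<sigma>) E \<and>
      section_radius N (ellipsoid N p \<sigma>) E \<le> C * (sqrt (ln (1 / \<delta>)) / \<delta>) * sqrt (real n) * \<sigma> (n + 1))
    \<ge> 1 - 2 * \<delta> - real n * exp (- (1 / 12) * real n)"
proof -
  let ?K = "ellipsoid N p \<sigma>"
  define lo where "lo = 1 / (C * sqrt (ln (1 / \<delta>))) * sqrt (real n) * \<sigma> (n + 1)"
  define hi where "hi = C * (sqrt (ln (1 / \<delta>)) / \<delta>) * sqrt (real n) * \<sigma> (n + 1)"
  define r where "r = sqrt q"
  have r: "0 < r" "r < 1" "r\<^sup>2 = q" using q by (auto simp: r_def)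
  have \<sigma>pos: "0 < \<sigma> j" if "j \<in> {1..N}" for j using \<sigma>[OF that] \<sigma>1 q by simp
  have \<sigma>n: "0 < \<sigma> (n+1)" using \<sigma>pos n by simp
  have L1: "1 \<le> ln (1 / \<delta>)"
  proof -
    have "3 \<le> 1 / \<delta>" using \<delta> by (simp add: field_simps)
    with exp_le have "exp 1 \<le> 1 / \<delta>" by (rule order_trans)
    thus ?thesis using \<delta> by (subst ln_ge_iff) auto
  qed
  have n24: "24 \<le> n" using n(1) L1 by linarith
  have C: "5 / (1 - r) ^ 3 \<le> C" "5 / (1 - q)\<^sup>2 \<le> C" "0 < C"
    using r q unfolding C_def r_def[symmetric] by (auto intro!: add_pos_pos)
  have prob: "prob_space \<mu>" and sets: "sets \<mu> = sets (grassmannian_borel N n)"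
    using haar by (auto simp: haar_grassmannian_def)
  interpret prob_space \<mu> by (rule prob)
  have space: "space \<mu> = grassmannian N n"
    using sets_eq_imp_space_eq[OF sets] by (simp add: space_grassmannian_borel)
  define Bad1 where "Bad1 j = {E \<in> space \<mu>. \<forall>x\<in>E \<inter> unit_sphere (insert j {1..n}).
      \<bar>x j\<bar> \<le> transversality_level n \<delta> r (j - (n+1))}" for j
  define Bad2 where "Bad2 i = {E \<in> space \<mu>. \<forall>x\<in>E \<inter> unit_sphere {1..n+1}.
      flatness_level n \<delta> (n+1-i) \<le> \<bar>x i\<bar>}" for i
  let ?B1 = "\<Union>j\<in>{n+1..N}. Bad1 j" and ?B2 = "\<Union>i\<in>{1..n+1}. Bad2 i"
  have B1: "?B1 \<in> events" "prob ?B1 \<le> \<delta> + 2 * exp (- real (n + 1))"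
    using transversality_failure[OF haar n(2) \<delta>(1) r(1,2)] unfolding Bad1_def by auto
  have B2: "?B2 \<in> events" "prob ?B2 \<le> \<delta> + real (n + 1) * exp (- real (n + 1) / 6)"
    using flatness_failure[OF haar n(2) \<delta>] unfolding Bad2_def by auto
  have meas: "section_radius N ?K \<in> borel_measurable \<mu>"
  proof -
    have "compact ?K" using p \<sigma>pos by (intro compact_ellipsoid(1)) auto
    moreover have "?K \<subseteq> rn_space N" "(\<lambda>_. 0) \<in> ?K" by (auto simp: ellipsoid_def rn_space_def)
    ultimately have "section_radius N ?K \<in> borel_measurable (grassmannian_borel N n)"
      by (rule measurable_section_radius)
    thus ?thesis by (simp cong: measurable_cong_sets add: sets)
  qed
  have good: "lo \<le> section_radius N ?K E \<and> section_radius N ?K E \<le> hi"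
    if E: "E \<in> space \<mu>" "E \<notin> ?B1 \<union> ?B2" for E
  proof -
    have Eg: "E \<in> grassmannian N n" using E space by simp
    have tpos: "0 < transversality_level n \<delta> r (j - (n+1))" for j
      using \<delta> r by (simp add: transversality_level_def)
    have trans: "\<exists>x\<in>E \<inter> unit_sphere (insert j {1..n}). transversality_level n \<delta> r (j - (n+1)) < \<bar>x j\<bar>"
      if "j \<in> {n+1..N}" for j
      using E that by (auto simp: Bad1_def not_le)
    have flat: "\<exists>x\<in>E \<inter> unit_sphere {1..n+1}. \<bar>x i\<bar> < flatness_level n \<delta> (n+1-i)"
      if "i \<in> {1..n+1}" for i
      using E that by (auto simp: Bad2_def not_le)
    have "lo \<le> section_radius N ?K E"
    proof (rule section_radius_ge[where \<sigma> = \<sigma> and n = n, OF Eg n(2) less_imp_le[OF p] \<sigma>pos tpos trans flat])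
      show "0 \<le> lo" using C \<sigma>n L1 by (simp add: lo_def)
      show "(\<Sum>i=1..n+1. lo * flatness_level n \<delta> (n+1-i) / \<sigma> i) \<le> 1"
        unfolding lo_def
      proof (rule lower_radius_sum_le[where \<sigma> = \<sigma> and n = n, OF _ \<delta>(1) _ q \<sigma>n _ C(2)])
        fix i assume i: "i \<in> {1..n+1}"
        have "\<sigma> i * q ^ (n+1-i) = \<sigma> 1 * (q ^ (i - 1) * q ^ (n+1-i))"
          using \<sigma>[of i] i n by simp
        also have "q ^ (i - 1) * q ^ (n+1-i) = q ^ n"
          using i by (simp flip: power_add)
        finally show "\<sigma> (n+1) = \<sigma> i * q ^ (n+1-i)" using \<sigma>[of "n+1"] n by simp
      qed (use n24 \<delta> in auto)
    qed
    moreover have "section_radius N ?K E \<le> (\<Sum>j=n+1..N. \<sigma> j / transversality_level n \<delta> r (j - (n+1)))"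
      by (rule section_radius_le[where \<sigma> = \<sigma> and n = n, OF Eg n(2) _ \<sigma>pos tpos trans]) (use p in auto)
    moreover have "\<dots> \<le> 5 / (1 - r) ^ 3 * (1 / \<delta>) * sqrt (real n) * \<sigma> (n+1)"
    proof (rule upper_radius_sum_le[where \<sigma> = \<sigma> and n = n, OF _ n(2) \<delta>(1) r(1,2) \<sigma>n])
      fix j assume j: "j \<in> {n+1..N}"
      have "\<sigma> j = \<sigma> 1 * q ^ (n + (j - (n+1)))" using \<sigma>[of j] j by simp
      thus "\<sigma> j = \<sigma> (n+1) * (r\<^sup>2) ^ (j - (n+1))"
        using \<sigma>[of "n+1"] n by (simp add: power_add r(3))
    qed (use n24 in auto)
    moreover have "5 / (1 - r) ^ 3 * (1 / \<delta>) * sqrt (real n) * \<sigma> (n+1) \<le> hi"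
      unfolding hi_def using C \<delta> L1 \<sigma>n r
      by (intro mult_right_mono mult_mono divide_right_mono) auto
    ultimately show ?thesis by linarith
  qed
  have "prob (?B1 \<union> ?B2) \<le> 2 * \<delta> + real n * exp (- (1 / 12) * real n)"
    using measure_Un_le[OF B1(1) B2(1)] B1(2) B2(2) exponential_failure_le[OF n24] by linarith
  moreover have "prob (space \<mu> - (?B1 \<union> ?B2)) = 1 - prob (?B1 \<union> ?B2)"
    using B1(1) B2(1) by (intro prob_compl) auto
  moreover have "prob (space \<mu> - (?B1 \<union> ?B2))
      \<le> prob {E \<in> space \<mu>. lo \<le> section_radius N ?K E \<and> section_radius N ?K E \<le> hi}"
  proof (rule finite_measure_mono)
    show "space \<mu> - (?B1 \<union> ?B2)
        \<subseteq> {E \<in> space \<mu>. lo \<le> section_radius N ?K E \<and> section_radius N ?K E \<le> hi}"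
      using good by blast
    note [measurable] = meas
    show "{E \<in> space \<mu>. lo \<le> section_radius N ?K E \<and> section_radius N ?K E \<le> hi} \<in> events"
      by measurable
  qed
  ultimately show ?thesis unfolding lo_def hi_def by linarith
qed

theorem proposition6p1:
  shows "\<exists>c \<gamma> \<delta>\<^sub>0 :: real. 0 < c \<and> 0 < \<gamma> \<and> 0 < \<delta>\<^sub>0 \<and> \<delta>\<^sub>0 < 1 \<and>
    (\<forall>p q :: real. 1 < p \<and> 0 < q \<and> q < 1 \<longrightarrow>
      (\<exists>C :: real. 0 < C \<and>
        (\<forall>(N::nat) (\<sigma> :: nat \<Rightarrow> real).
          2 \<le> N \<and> 0 < \<sigma> 1 \<and> (\<forall>j\<in>{1..N}. \<sigma> j = \<sigma> 1 * q ^ (j - 1)) \<longrightarrow>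
          (\<forall>(\<delta>::real) (n::nat) \<mu>.
            0 < \<delta> \<and> \<delta> \<le> \<delta>\<^sub>0 \<and> c * ln (1 / \<delta>) \<le> real n \<and> n < N \<and>
            haar_grassmannian N n \<mu> \<longrightarrow>
            \<P>(E in \<mu>.
                1 / (C * sqrt (ln (1 / \<delta>))) * sqrt (real n) * \<sigma> (n + 1)
                  \<le> section_radius N (ellipsoid N p \<sigma>) E \<and>
                section_radius N (ellipsoid N p \<sigma>) E
                  \<le> C * (sqrt (ln (1 / \<delta>)) / \<delta>) * sqrt (real n) * \<sigma> (n + 1))
              \<ge> 1 - 2 * \<delta> - real n * exp (- \<gamma> * real n)))))"
proof (rule exI[of _ "24::real"], rule exI[of _ "1/12::real"], rule exI[of _ "1/3::real"],
    intro conjI allI impI)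
  fix p q :: real
  assume pq: "1 < p \<and> 0 < q \<and> q < 1"
  let ?C = "5 / (1 - sqrt q) ^ 3 + 5 / (1 - q)\<^sup>2"
  show "\<exists>C :: real. 0 < C \<and>
        (\<forall>(N::nat) (\<sigma> :: nat \<Rightarrow> real).
          2 \<le> N \<and> 0 < \<sigma> 1 \<and> (\<forall>j\<in>{1..N}. \<sigma> j = \<sigma> 1 * q ^ (j - 1)) \<longrightarrow>
          (\<forall>(\<delta>::real) (n::nat) \<mu>.
            0 < \<delta> \<and> \<delta> \<le> 1/3 \<and> 24 * ln (1 / \<delta>) \<le> real n \<and> n < N \<and>
            haar_grassmannian N n \<mu> \<longrightarrow>
            \<P>(E in \<mu>.
                1 / (C * sqrt (ln (1 / \<delta>))) * sqrt (real n) * \<sigma> (n + 1)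
                  \<le> section_radius N (ellipsoid N p \<sigma>) E \<and>
                section_radius N (ellipsoid N p \<sigma>) E
                  \<le> C * (sqrt (ln (1 / \<delta>)) / \<delta>) * sqrt (real n) * \<sigma> (n + 1))
              \<ge> 1 - 2 * \<delta> - real n * exp (- (1/12) * real n)))"
  proof (rule exI[of _ ?C], intro conjI allI impI)
    show "0 < ?C" using pq by (auto intro!: add_pos_pos)
    fix N n :: nat and \<sigma> :: "nat \<Rightarrow> real" and \<delta> :: real and \<mu>
    assume *: "2 \<le> N \<and> 0 < \<sigma> 1 \<and> (\<forall>j\<in>{1..N}. \<sigma> j = \<sigma> 1 * q ^ (j - 1))"
      "0 < \<delta> \<and> \<delta> \<le> 1/3 \<and> 24 * ln (1 / \<delta>) \<le> real n \<and> n < N \<and> haar_grassmannian N n \<mu>"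
    show "1 - 2 * \<delta> - real n * exp (- (1/12) * real n) \<le>
        \<P>(E in \<mu>.
          1 / (?C * sqrt (ln (1 / \<delta>))) * sqrt (real n) * \<sigma> (n + 1)
            \<le> section_radius N (ellipsoid N p \<sigma>) E \<and>
          section_radius N (ellipsoid N p \<sigma>) E
            \<le> ?C * (sqrt (ln (1 / \<delta>)) / \<delta>) * sqrt (real n) * \<sigma> (n + 1))"
      by (rule section_radius_bounds_probability) (use pq * in blast)+
  qed
qed simp_all

end
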